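(* Let $\mathcal L$ contain a binary relation symbol $<$ and let $T$ be a complete $\mathcal L$-theory extending the theory of infinite linear orderings. If $T$ is quasi-o-minimal, then $T$ has the $\mathrm{VC}1$ property, and hence $\mathrm{vc}^T(n)=n$ for every $n$.
   Context: $T$ is quasi-o-minimal if in every model $\mathbf M$ of $T$, every definable (with parameters) subset of $M$ is a finite Boolean combination of singletons, intervals of $M$, and $\emptyset$-definable subsets of $M$. A uniform definition of $\Delta(x;B)$-types over finite sets in $\mathbf M$ with $d$ parameters (for a finite set $\Delta(x;y)$ of partitioned formulas) is a finite family $(\mathcal F_i)_{i\in I}$, $\mathcal F_i=(\varphi_i(y;y_1,\dots,y_d))_{\varphi\in\Delta}$, $|y_j|=|y|$, such that for every finite $B\subseteq M^{|y|}$ and every $a\in M^{|x|}$ there are $b_1,\dots,b_d\in B$ and $i\in I$ with $\mathbf M\models\varphi(a;b)\iff\mathbf M\models\varphi_i(b;b_1,\dots,b_d)$ for all $\varphi\in\Delta$, $b\in B$. A structure has the $\mathrm{VC}d$ property if every finite nonempty $\Delta(x;y)$ with $|x|=1$ has such a definition with $d$ parameters; $T$ has it if all models do. For a partitioned formula $\varphi(x;y)$ and model $\mathbf M$, the shatter function is $\pi_\varphi(t)=\max\{|\{S\cap A:S\in\mathcal S_\varphi\}|:A\subseteq M^{|x|},|A|=t\}$ where $\mathcal S_\varphi=\{\varphi(M^{|x|};b):b\in M^{|y|}\}$; the VC density $\mathrm{vc}(\varphi)=\inf\{r>0:\pi_\varphi(t)=O(t^r)\}$ ($\infty$ if none); it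 depends only on $T$. $\mathrm{vc}^T(n)=\sup\{\mathrm{vc}(\varphi):\varphi(x;y)\text{ an }\mathcal L\text{-formula with }|y|=n\}$.
   Formalization: In a uniform definition of types the finite sets B are required to be nonempty (for B empty no b_1 in B exists, so VC1 would fail in every structure); models are taken, up to isomorphism, inside an arbitrary universe with at least as many elements as there are formulas. *)

theory Defs
  imports Complex_Main "HOL-Library.Extended_Real" "HOL-Library.Landau_Symbols"
begin

section \<open>First-order logic\<close>

text \<open>A symbol belongs to the language iff its arity is not \<open>None\<close>; constants are 0-ary functions.\<close>

record ('f, 'r) lang =
  farity :: "'f \<Rightarrow> nat option"
  rarity :: "'r \<Rightarrow> nat option"

datatype 'f trm = Var nat | App 'f "'f trm list"

datatype ('f, 'r) fm =
    Eq "'f trm" "'f trm"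
  | Rel 'r "'f trm list"
  | Neg "('f, 'r) fm"
  | Conj "('f, 'r) fm" "('f, 'r) fm"
  | Ex nat "('f, 'r) fm"

fun wf_trm :: "('f, 'r) lang \<Rightarrow> 'f trm \<Rightarrow> bool" where
  "wf_trm L (Var v) \<longleftrightarrow> True"
| "wf_trm L (App f ts) \<longleftrightarrow> farity L f = Some (length ts) \<and> (\<forall>t\<in>set ts. wf_trm L t)"

fun wf_fm :: "('f, 'r) lang \<Rightarrow> ('f, 'r) fm \<Rightarrow> bool" where
  "wf_fm L (Eq s t) \<longleftrightarrow> wf_trm L s \<and> wf_trm L t"
| "wf_fm L (Rel R ts) \<longleftrightarrow> rarity L R = Some (length ts) \<and> (\<forall>t\<in>set ts. wf_trm L t)"
| "wf_fm L (Neg \<phi>) \<longleftrightarrow> wf_fm L \<phi>"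
| "wf_fm L (Conj \<phi> \<psi>) \<longleftrightarrow> wf_fm L \<phi> \<and> wf_fm L \<psi>"
| "wf_fm L (Ex v \<phi>) \<longleftrightarrow> wf_fm L \<phi>"

fun fv_trm :: "'f trm \<Rightarrow> nat set" where
  "fv_trm (Var v) = {v}"
| "fv_trm (App f ts) = (\<Union>t\<in>set ts. fv_trm t)"

fun fv :: "('f, 'r) fm \<Rightarrow> nat set" where
  "fv (Eq s t) = fv_trm s \<union> fv_trm t"
| "fv (Rel R ts) = (\<Union>t\<in>set ts. fv_trm t)"
| "fv (Neg \<phi>) = fv \<phi>"
| "fv (Conj \<phi> \<psi>) = fv \<phi> \<union> fv \<psi>"
| "fv (Ex v \<phi>) = fv \<phi> - {v}"

definition fmlas :: "('f, 'r) lang \<Rightarrow> nat \<Rightarrow> ('f, 'r) fm set" where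
  "fmlas L k = {\<phi>. wf_fm L \<phi> \<and> fv \<phi> \<subseteq> {..<k}}"

abbreviation sentences :: "('f, 'r) lang \<Rightarrow> ('f, 'r) fm set" where
  "sentences L \<equiv> fmlas L 0"

record ('f, 'r, 'm) struct =
  univ :: "'m set"
  funI :: "'f \<Rightarrow> 'm list \<Rightarrow> 'm"
  relI :: "'r \<Rightarrow> 'm list \<Rightarrow> bool"

definition tuples :: "('f, 'r, 'm) struct \<Rightarrow> nat \<Rightarrow> 'm list set" where
  "tuples M n = {a. length a = n \<and> set a \<subseteq> univ M}"

definition is_struct :: "('f, 'r) lang \<Rightarrow> ('f, 'r, 'm) struct \<Rightarrow> bool" where
  "is_struct L M \<longleftrightarrow> univ M \<noteq> {} \<and>
     (\<forall>f k. farity L f = Some k \<longrightarrow> (\<forall>a\<in>tuples M k. funI M f a \<in> univ M))"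

fun eval :: "('f, 'r, 'm) struct \<Rightarrow> (nat \<Rightarrow> 'm) \<Rightarrow> 'f trm \<Rightarrow> 'm" where
  "eval M e (Var v) = e v"
| "eval M e (App f ts) = funI M f (map (eval M e) ts)"

fun sat :: "('f, 'r, 'm) struct \<Rightarrow> (nat \<Rightarrow> 'm) \<Rightarrow> ('f, 'r) fm \<Rightarrow> bool" where
  "sat M e (Eq s t) \<longleftrightarrow> eval M e s = eval M e t"
| "sat M e (Rel R ts) \<longleftrightarrow> relI M R (map (eval M e) ts)"
| "sat M e (Neg \<phi>) \<longleftrightarrow> \<not> sat M e \<phi>"
| "sat M e (Conj \<phi> \<psi>) \<longleftrightarrow> sat M e \<phi> \<and> sat M e \<psi>"
| "sat M e (Ex v \<phi>) \<longleftrightarrow> (\<exists>a\<in>univ M. sat M (e(v := a)) \<phi>)"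

text \<open>\<open>holds M \<phi> a\<close> is \<open>M \<Turnstile> \<phi>(a)\<close>: the tuple \<open>a\<close> is assigned to the variables \<open>0, 1, \<dots>\<close>.
  Only meaningful if the free variables of \<open>\<phi>\<close> are below \<open>length a\<close>.\<close>

definition holds :: "('f, 'r, 'm) struct \<Rightarrow> ('f, 'r) fm \<Rightarrow> 'm list \<Rightarrow> bool" where
  "holds M \<phi> a \<longleftrightarrow> sat M (\<lambda>i. a ! i) \<phi>"

definition models :: "('f, 'r) lang \<Rightarrow> ('f, 'r) fm set \<Rightarrow> ('f, 'r, 'm) struct set" where
  "models L T = {M. is_struct L M \<and> (\<forall>\<sigma>\<in>T. holds M \<sigma> [])}"

text \<open>HOL cannot quantify over the models of \<open>T\<close> on all types at once, so notions that refer to all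
  models of a theory take as an additional argument a type \<open>'m\<close> that contains the universes.
  If \<open>'m\<close> has at least as many elements as there are formulas of \<open>L\<close>, then by Loewenheim-Skolem
  none of the notions below depends on the choice of \<open>'m\<close>.\<close>

definition entails :: "'m itself \<Rightarrow> ('f, 'r) lang \<Rightarrow> ('f, 'r) fm set \<Rightarrow> ('f, 'r) fm \<Rightarrow> bool" where
  "entails _ L T \<sigma> \<longleftrightarrow> (\<forall>M\<in>(models L T :: ('f, 'r, 'm) struct set). holds M \<sigma> [])"

definition complete_theory :: "'m itself \<Rightarrow> ('f, 'r) lang \<Rightarrow> ('f, 'r) fm set \<Rightarrow> bool" where
  "complete_theory U L T \<longleftrightarrow> T \<subseteq> sentences L \<and> (models L T :: ('f, 'r, 'm) struct set) \<noteq> {} \<and>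
     (\<forall>\<sigma>\<in>sentences L. entails U L T \<sigma> \<or> entails U L T (Neg \<sigma>))"

definition extends_theory ::
  "'m itself \<Rightarrow> ('f, 'r) lang \<Rightarrow> ('f, 'r) fm set \<Rightarrow> ('f, 'r) fm set \<Rightarrow> bool" where
  "extends_theory U L T T' \<longleftrightarrow> (\<forall>\<sigma>\<in>T'. entails U L T \<sigma>)"

section \<open>Infinite linear orderings\<close>

abbreviation All :: "nat \<Rightarrow> ('f, 'r) fm \<Rightarrow> ('f, 'r) fm" where
  "All v \<phi> \<equiv> Neg (Ex v (Neg \<phi>))"

abbreviation Disj :: "('f, 'r) fm \<Rightarrow> ('f, 'r) fm \<Rightarrow> ('f, 'r) fm" where
  "Disj \<phi> \<psi> \<equiv> Neg (Conj (Neg \<phi>) (Neg \<psi>))"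

abbreviation Impl :: "('f, 'r) fm \<Rightarrow> ('f, 'r) fm \<Rightarrow> ('f, 'r) fm" where
  "Impl \<phi> \<psi> \<equiv> Disj (Neg \<phi>) \<psi>"

abbreviation Less :: "'r \<Rightarrow> nat \<Rightarrow> nat \<Rightarrow> ('f, 'r) fm" where
  "Less lt v w \<equiv> Rel lt [Var v, Var w]"

definition Distinct :: "nat \<Rightarrow> ('f, 'r) fm" where
  "Distinct n = foldr Conj [Neg (Eq (Var i) (Var j)). j \<leftarrow> [0..<n], i \<leftarrow> [0..<j]] (Eq (Var 0) (Var 0))"

definition AtLeast :: "nat \<Rightarrow> ('f, 'r) fm" where
  "AtLeast n = foldr Ex [0..<Suc n] (Distinct (Suc n))"

definition infinite_linear_order_axioms :: "'r \<Rightarrow> ('f, 'r) fm set" where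
  "infinite_linear_order_axioms lt =
     {All 0 (Neg (Less lt 0 0)),
      All 0 (All 1 (All 2 (Impl (Conj (Less lt 0 1) (Less lt 1 2)) (Less lt 0 2)))),
      All 0 (All 1 (Disj (Less lt 0 1) (Disj (Eq (Var 0) (Var 1)) (Less lt 1 0))))}
     \<union> range AtLeast"

lemma sat_foldr_Conj: "sat M e (foldr Conj \<phi>s \<psi>) \<longleftrightarrow> (\<forall>\<phi>\<in>set \<phi>s. sat M e \<phi>) \<and> sat M e \<psi>"
  by (induction \<phi>s) auto

lemma sat_foldr_Ex:
  "sat M e (foldr Ex [k..<k+n] \<phi>) \<longleftrightarrow>
     (\<exists>g. g ` {k..<k+n} \<subseteq> univ M \<and> sat M (\<lambda>i. if i \<in> {k..<k+n} then g i else e i) \<phi>)"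
proof (induction n arbitrary: k e)
  case 0
  then show ?case by simp
next
  case (Suc n)
  have upt: "[k..<k + Suc n] = k # [Suc k..<Suc k + n]"
    by (simp add: upt_conv_Cons del: upt_Suc)
  have *: "(\<lambda>i. if i \<in> {Suc k..<Suc k + n} then g i else (e(k := a)) i)
         = (\<lambda>i. if i \<in> {k..<k + Suc n} then (g(k := a)) i else e i)" for g a
    by (auto simp: fun_eq_iff)
  have "sat M e (foldr Ex [k..<k + Suc n] \<phi>) \<longleftrightarrow>
      (\<exists>a\<in>univ M. \<exists>g. g ` {Suc k..<Suc k + n} \<subseteq> univ M \<and>
         sat M (\<lambda>i. if i \<in> {k..<k + Suc n} then (g(k := a)) i else e i) \<phi>)"
    unfolding upt by (simp only: foldr.simps comp_def sat.simps Suc.IH *)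
  also have "\<dots> \<longleftrightarrow> (\<exists>g. g ` {k..<k + Suc n} \<subseteq> univ M \<and>
         sat M (\<lambda>i. if i \<in> {k..<k + Suc n} then g i else e i) \<phi>)" (is "?l \<longleftrightarrow> ?r")
  proof
    assume ?l
    then obtain a g where "a \<in> univ M" "g ` {Suc k..<Suc k + n} \<subseteq> univ M"
      "sat M (\<lambda>i. if i \<in> {k..<k + Suc n} then (g(k := a)) i else e i) \<phi>" by blast
    moreover from this have "(g(k := a)) ` {k..<k + Suc n} \<subseteq> univ M"
      by (auto simp: image_subset_iff)
    ultimately show ?r by blast
  next
    assume ?r
    then obtain g where g: "g ` {k..<k + Suc n} \<subseteq> univ M"
      "sat M (\<lambda>i. if i \<in> {k..<k + Suc n} then g i else e i) \<phi>" by blast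
    then have "g k \<in> univ M" "g ` {Suc k..<Suc k + n} \<subseteq> univ M"
      by (auto simp: image_subset_iff)
    with g(2) show ?l by (intro bexI[of _ "g k"] exI[of _ g]) (simp_all only: fun_upd_triv)
  qed
  finally show ?case .
qed

lemma sat_Distinct: "sat M e (Distinct n) \<longleftrightarrow> inj_on e {..<n}"
proof -
  have "sat M e (Distinct n) \<longleftrightarrow> (\<forall>j<n. \<forall>i<j. e i \<noteq> e j)"
    unfolding Distinct_def sat_foldr_Conj by (auto simp del: upt_Suc)
  also have "\<dots> \<longleftrightarrow> inj_on e {..<n}"
    by (auto simp: inj_on_def) (metis linorder_neqE_nat)
  finally show ?thesis .
qed

lemma holds_AtLeast:
  "holds M (AtLeast n) a \<longleftrightarrow> infinite (univ M) \<or> Suc n \<le> card (univ M)"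
proof -
  have "holds M (AtLeast n) a \<longleftrightarrow> (\<exists>g. g ` {..<Suc n} \<subseteq> univ M \<and> inj_on g {..<Suc n})"
  proof -
    have "inj_on (\<lambda>i. if i \<in> {0..<0+Suc n} then g i else a ! i) {..<Suc n}
          \<longleftrightarrow> inj_on g {..<Suc n}" for g
      by (rule inj_on_cong) simp
    then show ?thesis
      using sat_foldr_Ex[of M "\<lambda>i. a ! i" 0 "Suc n" "Distinct (Suc n)"]
      unfolding holds_def AtLeast_def sat_Distinct by (simp add: lessThan_atLeast0)
  qed
  also have "\<dots> \<longleftrightarrow> infinite (univ M) \<or> Suc n \<le> card (univ M)" (is "?l \<longleftrightarrow> ?r")
  proof
    assume ?l
    then show ?r by (metis card_image card_lessThan card_mono)
  next
    assume ?r
    then obtain B where B: "B \<subseteq> univ M" "finite B" "card B = Suc n"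
      by (metis infinite_arbitrarily_large obtain_subset_with_card_n)
    then obtain g where "bij_betw g {..<Suc n} B"
      by (metis bij_betw_iff_card card_lessThan finite_lessThan)
    with B(1) show ?l by (metis bij_betw_def)
  qed
  finally show ?thesis .
qed

lemma holds_infinite_linear_order_axioms:
  "(\<forall>\<sigma>\<in>infinite_linear_order_axioms lt. holds M \<sigma> []) \<longleftrightarrow>
     infinite (univ M) \<and>
     (\<forall>a\<in>univ M. \<not> relI M lt [a, a]) \<and>
     (\<forall>a\<in>univ M. \<forall>b\<in>univ M. \<forall>c\<in>univ M.
        relI M lt [a, b] \<longrightarrow> relI M lt [b, c] \<longrightarrow> relI M lt [a, c]) \<and>
     (\<forall>a\<in>univ M. \<forall>b\<in>univ M. relI M lt [a, b] \<or> a = b \<or> relI M lt [b, a])"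
proof -
  have "(\<forall>n. infinite (univ M) \<or> Suc n \<le> card (univ M)) \<longleftrightarrow> infinite (univ M)"
    by (metis Suc_n_not_le_n)
  then have "(\<forall>\<sigma>\<in>range AtLeast. holds M \<sigma> []) \<longleftrightarrow> infinite (univ M)"
    by (simp add: holds_AtLeast)
  then show ?thesis
    unfolding infinite_linear_order_axioms_def ball_Un by (auto simp: holds_def)
qed

section \<open>Quasi-o-minimality\<close>

definition zero_definable :: "('f, 'r) lang \<Rightarrow> ('f, 'r, 'm) struct \<Rightarrow> 'm set \<Rightarrow> bool" where
  "zero_definable L M S \<longleftrightarrow> (\<exists>\<phi>\<in>fmlas L 1. S = {a\<in>univ M. holds M \<phi> [a]})"

definition definable :: "('f, 'r) lang \<Rightarrow> ('f, 'r, 'm) struct \<Rightarrow> 'm set \<Rightarrow> bool" where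
  "definable L M S \<longleftrightarrow>
     (\<exists>k. \<exists>\<phi>\<in>fmlas L (1 + k). \<exists>c\<in>tuples M k. S = {a\<in>univ M. holds M \<phi> (a # c)})"

text \<open>Intervals have endpoints in \<open>M \<union> {\<plusminus>\<infinity>}\<close>, with \<open>None\<close> for an infinite endpoint. Only open ones
  are listed: the others differ from these by at most two singletons.\<close>

definition interval :: "'r \<Rightarrow> ('f, 'r, 'm) struct \<Rightarrow> 'm option \<Rightarrow> 'm option \<Rightarrow> 'm set" where
  "interval lt M l u = {a\<in>univ M. (\<forall>b. l = Some b \<longrightarrow> relI M lt [b, a]) \<and>
                                  (\<forall>b. u = Some b \<longrightarrow> relI M lt [a, b])}"

definition intervals :: "'r \<Rightarrow> ('f, 'r, 'm) struct \<Rightarrow> 'm set set" where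
  "intervals lt M = {interval lt M l u | l u. set_option l \<subseteq> univ M \<and> set_option u \<subseteq> univ M}"

inductive_set bool_comb :: "'a set \<Rightarrow> 'a set set \<Rightarrow> 'a set set" for X :: "'a set" and G where
  gen: "A \<in> G \<Longrightarrow> A \<in> bool_comb X G"
| compl: "A \<in> bool_comb X G \<Longrightarrow> X - A \<in> bool_comb X G"
| union: "A \<in> bool_comb X G \<Longrightarrow> B \<in> bool_comb X G \<Longrightarrow> A \<union> B \<in> bool_comb X G"

definition quasi_o_minimal ::
  "'m itself \<Rightarrow> ('f, 'r) lang \<Rightarrow> 'r \<Rightarrow> ('f, 'r) fm set \<Rightarrow> bool" where
  "quasi_o_minimal _ L lt T \<longleftrightarrow>
     (\<forall>M\<in>(models L T :: ('f, 'r, 'm) struct set). \<forall>S. definable L M S \<longrightarrow>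
        S \<in> bool_comb (univ M)
              ({{a} | a. a \<in> univ M} \<union> intervals lt M \<union> {Z. zero_definable L M Z}))"

section \<open>Uniform definability of types over finite sets\<close>

text \<open>A partitioned formula \<open>\<phi>(x;y)\<close> with \<open>|x| = m\<close> and \<open>|y| = n\<close> is an element of \<open>fmlas L (m + n)\<close>:
  \<open>x\<close> consists of the variables \<open>0, \<dots>, m - 1\<close> and \<open>y\<close> of the variables \<open>m, \<dots>, m + n - 1\<close>.

  In a uniform definition, \<open>\<F>\<close> is the (finite) set of the families \<open>(\<phi>\<^sub>i)\<close>, \<open>\<phi> \<in> \<Delta>\<close>, each given as
  a map from \<open>\<Delta>\<close> to formulas in the variables \<open>y, y\<^sub>1, \<dots>, y\<^sub>d\<close>. The set \<open>B\<close> has to be nonempty,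
  since for \<open>d \<ge> 1\<close> there is no choice of \<open>b\<^sub>1, \<dots>, b\<^sub>d\<close> in the empty set.\<close>

definition uniform_definition ::
  "('f, 'r) lang \<Rightarrow> ('f, 'r, 'm) struct \<Rightarrow> nat \<Rightarrow> nat \<Rightarrow> ('f, 'r) fm set \<Rightarrow> nat \<Rightarrow>
     (('f, 'r) fm \<Rightarrow> ('f, 'r) fm) set \<Rightarrow> bool" where
  "uniform_definition L M m n \<Delta> d \<F> \<longleftrightarrow>
     finite \<F> \<and> (\<forall>F\<in>\<F>. \<forall>\<phi>\<in>\<Delta>. F \<phi> \<in> fmlas L (n + d * n)) \<and>
     (\<forall>B a. finite B \<and> B \<noteq> {} \<and> B \<subseteq> tuples M n \<and> a \<in> tuples M m \<longrightarrow>
        (\<exists>bs. length bs = d \<and> set bs \<subseteq> B \<and>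
           (\<exists>F\<in>\<F>. \<forall>\<phi>\<in>\<Delta>. \<forall>b\<in>B. holds M \<phi> (a @ b) \<longleftrightarrow> holds M (F \<phi>) (b @ concat bs))))"

definition VC_property_struct ::
  "('f, 'r) lang \<Rightarrow> ('f, 'r, 'm) struct \<Rightarrow> nat \<Rightarrow> bool" where
  "VC_property_struct L M d \<longleftrightarrow>
     (\<forall>n \<Delta>. finite \<Delta> \<and> \<Delta> \<noteq> {} \<and> \<Delta> \<subseteq> fmlas L (1 + n) \<longrightarrow>
        (\<exists>\<F>. uniform_definition L M 1 n \<Delta> d \<F>))"

definition VC_property :: "'m itself \<Rightarrow> ('f, 'r) lang \<Rightarrow> ('f, 'r) fm set \<Rightarrow> nat \<Rightarrow> bool" where
  "VC_property _ L T d \<longleftrightarrow>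
     (\<forall>M\<in>(models L T :: ('f, 'r, 'm) struct set). VC_property_struct L M d)"

section \<open>VC density\<close>

definition def_family ::
  "('f, 'r, 'm) struct \<Rightarrow> nat \<Rightarrow> nat \<Rightarrow> ('f, 'r) fm \<Rightarrow> 'm list set set" where
  "def_family M m n \<phi> = {{a\<in>tuples M m. holds M \<phi> (a @ b)} | b. b \<in> tuples M n}"

text \<open>The set below is bounded by \<open>2 ^ t\<close>, so its supremum is its maximum. It is empty only if
  \<open>M\<^sup>m\<close> has fewer than \<open>t\<close> elements, that is, for infinite \<open>M\<close>, if \<open>m = 0\<close> and \<open>t > 1\<close>; the
  supremum is then 0.\<close>

definition shatter_function ::
  "('f, 'r, 'm) struct \<Rightarrow> nat \<Rightarrow> nat \<Rightarrow> ('f, 'r) fm \<Rightarrow> nat \<Rightarrow> nat" where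
  "shatter_function M m n \<phi> t =
     Sup {card {S \<inter> A | S. S \<in> def_family M m n \<phi>} | A. A \<subseteq> tuples M m \<and> finite A \<and> card A = t}"

definition vc_density :: "('f, 'r, 'm) struct \<Rightarrow> nat \<Rightarrow> nat \<Rightarrow> ('f, 'r) fm \<Rightarrow> ereal" where
  "vc_density M m n \<phi> =
     Inf {ereal r | r. r > 0 \<and>
            (\<lambda>t. real (shatter_function M m n \<phi> t)) \<in> O(\<lambda>t. real t powr r)}"

text \<open>The VC density of a formula is the same in all models of a complete theory \<open>T\<close>. Hence
  \<open>vc_fun L M\<close>, for an arbitrary model \<open>M\<close> of \<open>T\<close>, is the function \<open>vc\<^sup>T\<close>.\<close>

definition vc_fun :: "('f, 'r) lang \<Rightarrow> ('f, 'r, 'm) struct \<Rightarrow> nat \<Rightarrow> ereal" where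
  "vc_fun L M n = Sup {vc_density M m n \<phi> | m \<phi>. \<phi> \<in> fmlas L (m + n)}"

end

theory Submission
  imports Defs
begin

text \<open>Compactness turns quasi-o-minimality into a uniform statement: for \<open>\<phi>(x;y)\<close> with \<open>|x| = 1\<close> there are
  finitely many formulas \<open>\<psi>(x)\<close> and a bound \<open>N\<close> such that, on each cell cut out by the \<open>\<psi>\<close>, every
  \<open>\<phi>(M;b)\<close> changes its truth value fewer than \<open>N\<close> times. Then \<open>\<phi>(x;b)\<close> is a Boolean combination of
  the \<open>\<psi>(x)\<close> and of final segments of \<open>M\<close> defined uniformly over \<open>b\<close>. Final segments are linearly ordered
  by inclusion, so the type of \<open>a\<close> over a finite set \<open>B\<close> is given by its cell and by the smallest of the
  segments over \<open>B\<close> that contains \<open>a\<close>, hence by one parameter. Adding one variable at a time, types in \<open>n\<close>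
  variables need \<open>n\<close> parameters, so there are \<open>O(|B|\<^sup>n)\<close> of them; the formula
  \<open>x = y\<^sub>1 \<or> \<dots> \<or> x = y\<^sub>n\<close> attains this growth.\<close>

section \<open>Relations defined by the same formula in all structures\<close>

text \<open>The endpoints that quasi-o-minimality supplies for \<phi>(M;b) are arbitrary elements of
  the model: they need not be definable from b, and nothing bounds their number a priori as b
  varies. Counting alternations avoids both difficulties. That x lies at or above an alternating
  chain of length i is first-order in x and b, and the set of such x is a final segment whatever
  \<phi>, b and the cell are. The segments of all formulas in \<Delta> thus form a single chain
  under inclusion, which is why one parameter serves the whole of \<Delta>.

  For the bound, suppose that every pair (\<Psi>, N) has a bad b. Larger pairs have fewer bad
  tuples, so some ultrafilter contains all sets of bad tuples, and the tuple it represents in an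
  ultrapower is bad for every pair at once, against quasi-o-minimality there. The hypothesis,
  however, concerns models on the fixed type \<open>'m\<close>, in general too small for an
  ultrapower. The Skolem hull of that one tuple has no more elements than there are formulas, so the
  injection \<open>h\<close> places it inside \<open>'m\<close>.\<close>

lemma eval_cong: "(\<And>v. v \<in> fv_trm t \<Longrightarrow> e v = e' v) \<Longrightarrow> eval M e t = eval M e' t"
proof (induction t)
  case (App f ts)
  then have "map (eval M e) ts = map (eval M e') ts"
    by (intro map_cong refl) auto
  then show ?case by (simp del: map_eq_conv)
qed simp

lemma sat_cong: "(\<And>v. v \<in> fv \<phi> \<Longrightarrow> e v = e' v) \<Longrightarrow> sat M e \<phi> \<longleftrightarrow> sat M e' \<phi>"
proof (induction \<phi> arbitrary: e e')
  case (Eq s t)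
  then show ?case using eval_cong[of s e e' M] eval_cong[of t e e' M] by simp
next
  case (Rel R ts)
  then have "map (eval M e) ts = map (eval M e') ts"
    by (intro map_cong refl eval_cong) auto
  then show ?case by (simp del: map_eq_conv)
next
  case (Ex v \<phi>)
  have "sat M (e(v := a)) \<phi> \<longleftrightarrow> sat M (e'(v := a)) \<phi>" for a
    using Ex.prems by (intro Ex.IH) auto
  then show ?case by simp
next
  case (Neg \<phi>)
  have "sat M e \<phi> \<longleftrightarrow> sat M e' \<phi>" using Neg.prems by (intro Neg.IH) auto
  then show ?case by simp
next
  case (Conj \<phi> \<psi>)
  have "sat M e \<phi> \<longleftrightarrow> sat M e' \<phi>" "sat M e \<psi> \<longleftrightarrow> sat M e' \<psi>"
    using Conj.prems by (auto intro!: Conj.IH)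
  then show ?case by simp
qed

lemma finite_fv_trm: "finite (fv_trm t)"
  by (induction t) auto

lemma finite_fv: "finite (fv \<phi>)"
  by (induction \<phi>) (auto simp: finite_fv_trm)

fun rename_trm :: "(nat \<Rightarrow> nat) \<Rightarrow> 'f trm \<Rightarrow> 'f trm" where
  "rename_trm \<sigma> (Var v) = Var (\<sigma> v)"
| "rename_trm \<sigma> (App f ts) = App f (map (rename_trm \<sigma>) ts)"

lemma wf_rename_trm: "wf_trm L t \<Longrightarrow> wf_trm L (rename_trm \<sigma> t)"
  by (induction t) auto

lemma fv_rename_trm: "fv_trm (rename_trm \<sigma> t) = \<sigma> ` fv_trm t"
  by (induction t) auto

lemma eval_rename_trm: "eval M e (rename_trm \<sigma> t) = eval M (\<lambda>u. e (\<sigma> u)) t"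
proof (induction t)
  case (App f ts)
  then have "map (\<lambda>t. eval M e (rename_trm \<sigma> t)) ts = map (eval M (\<lambda>u. e (\<sigma> u))) ts"
    by (intro map_cong refl) auto
  then show ?case by (simp add: comp_def del: map_eq_conv)
qed simp

text \<open>Only capture has to be avoided: under \<open>Ex\<close> the bound variable becomes some
  w outside the image of the other free variables, and the induction hypothesis is used for \<sigma>
  changed at v. Asking for mere existence spares a function that chooses fresh variables.\<close>

lemma ex_rename:
  assumes "wf_fm L \<phi>"
  shows "\<exists>\<phi>'. wf_fm L \<phi>' \<and> fv \<phi>' \<subseteq> \<sigma> ` fv \<phi> \<and>
    (\<forall>(M :: ('f, 'r, 'm) struct) e. sat M e \<phi>' \<longleftrightarrow> sat M (\<lambda>u. e (\<sigma> u)) \<phi>)"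
  using assms
proof (induction \<phi> arbitrary: \<sigma>)
  case (Eq s t)
  show ?case
    by (rule exI[of _ "Eq (rename_trm \<sigma> s) (rename_trm \<sigma> t)"])
      (use Eq in \<open>auto simp: wf_rename_trm fv_rename_trm eval_rename_trm\<close>)
next
  case (Rel R ts)
  show ?case
    by (rule exI[of _ "Rel R (map (rename_trm \<sigma>) ts)"])
      (use Rel in \<open>auto simp: wf_rename_trm fv_rename_trm eval_rename_trm comp_def\<close>)
next
  case (Neg \<phi>)
  obtain \<phi>' where "wf_fm L \<phi>'" "fv \<phi>' \<subseteq> \<sigma> ` fv \<phi>"
    "\<forall>(M :: ('f, 'r, 'm) struct) e. sat M e \<phi>' \<longleftrightarrow> sat M (\<lambda>u. e (\<sigma> u)) \<phi>"
    using Neg.IH[of \<sigma>] Neg.prems by auto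
  then show ?case by (intro exI[of _ "Neg \<phi>'"]) auto
next
  case (Conj \<phi> \<psi>)
  obtain \<phi>' where "wf_fm L \<phi>'" "fv \<phi>' \<subseteq> \<sigma> ` fv \<phi>"
    "\<forall>(M :: ('f, 'r, 'm) struct) e. sat M e \<phi>' \<longleftrightarrow> sat M (\<lambda>u. e (\<sigma> u)) \<phi>"
    using Conj.IH(1)[of \<sigma>] Conj.prems by auto
  moreover obtain \<psi>' where "wf_fm L \<psi>'" "fv \<psi>' \<subseteq> \<sigma> ` fv \<psi>"
    "\<forall>(M :: ('f, 'r, 'm) struct) e. sat M e \<psi>' \<longleftrightarrow> sat M (\<lambda>u. e (\<sigma> u)) \<psi>"
    using Conj.IH(2)[of \<sigma>] Conj.prems by auto
  ultimately show ?case by (intro exI[of _ "Conj \<phi>' \<psi>'"]) auto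
next
  case (Ex v \<phi>)
  obtain w where w: "w \<notin> \<sigma> ` (fv \<phi> - {v})"
    using ex_new_if_finite[of "\<sigma> ` (fv \<phi> - {v})"] finite_fv[of \<phi>] by auto
  obtain \<phi>' where \<phi>': "wf_fm L \<phi>'" "fv \<phi>' \<subseteq> (\<sigma>(v := w)) ` fv \<phi>"
    "\<forall>(M :: ('f, 'r, 'm) struct) e. sat M e \<phi>' \<longleftrightarrow> sat M (\<lambda>u. e ((\<sigma>(v := w)) u)) \<phi>"
    using Ex.IH[of "\<sigma>(v := w)"] Ex.prems by auto
  have "sat M (\<lambda>u. (e(w := a)) ((\<sigma>(v := w)) u)) \<phi> \<longleftrightarrow> sat M ((\<lambda>u. e (\<sigma> u))(v := a)) \<phi>"
    for M :: "('f, 'r, 'm) struct" and e a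
    using w by (intro sat_cong) auto
  then show ?case
    using \<phi>' by (intro exI[of _ "Ex w \<phi>'"]) auto
qed

text \<open>The formula is chosen before the structure. This uniformity allows a statement about
  alternations in \<open>M\<close> to be transferred to \<open>skolem_hull\<close> through a single
  formula.\<close>

definition definable_rel ::
  "('f, 'r) lang \<Rightarrow> nat \<Rightarrow> (('f, 'r, 'm) struct \<Rightarrow> 'm list \<Rightarrow> bool) \<Rightarrow> bool" where
  "definable_rel L k R \<longleftrightarrow> (\<exists>\<phi>\<in>fmlas L k. \<forall>M. \<forall>a\<in>tuples M k. holds M \<phi> a \<longleftrightarrow> R M a)"

lemma definable_rel_cong:
  assumes "definable_rel L k R" "\<And>M a. a \<in> tuples M k \<Longrightarrow> R M a \<longleftrightarrow> R' M a"
  shows "definable_rel L k R'"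
  using assms unfolding definable_rel_def by metis

lemma definable_rel_holds: "\<phi> \<in> fmlas L k \<Longrightarrow> definable_rel L k (\<lambda>M. holds M \<phi>)"
  unfolding definable_rel_def by blast

lemma definable_rel_const: "definable_rel L k (\<lambda>M a. c)"
proof -
  have *: "All 0 (Eq (Var 0) (Var 0)) \<in> fmlas L k" "Neg (All 0 (Eq (Var 0) (Var 0))) \<in> fmlas L k"
    by (auto simp: fmlas_def)
  show ?thesis
  proof (cases c)
    case True
    show ?thesis unfolding definable_rel_def
      by (rule bexI[OF _ *(1)]) (auto simp: holds_def True)
  next
    case False
    show ?thesis unfolding definable_rel_def
      by (rule bexI[OF _ *(2)]) (auto simp: holds_def False)
  qed
qed

lemma definable_rel_eq:
  assumes "i < k" "j < k"
  shows "definable_rel L k (\<lambda>M a. a ! i = a ! j)"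
  unfolding definable_rel_def
  by (rule bexI[of _ "Eq (Var i) (Var j)"]) (use assms in \<open>auto simp: holds_def fmlas_def\<close>)

lemma definable_rel_less:
  assumes "rarity L lt = Some 2" "i < k" "j < k"
  shows "definable_rel L k (\<lambda>M a. relI M lt [a ! i, a ! j])"
  unfolding definable_rel_def
  by (rule bexI[of _ "Less lt i j"]) (use assms in \<open>auto simp: holds_def fmlas_def\<close>)

lemma definable_rel_not:
  assumes "definable_rel L k R"
  shows "definable_rel L k (\<lambda>M a. \<not> R M a)"
proof -
  obtain \<phi> where "\<phi> \<in> fmlas L k" "\<And>M a. a \<in> tuples M k \<Longrightarrow> holds M \<phi> a \<longleftrightarrow> R M a"
    using assms unfolding definable_rel_def by blast
  then show ?thesis unfolding definable_rel_def
    by (intro bexI[of _ "Neg \<phi>"]) (auto simp: holds_def fmlas_def)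
qed

lemma definable_rel_conj:
  assumes "definable_rel L k R" "definable_rel L k R'"
  shows "definable_rel L k (\<lambda>M a. R M a \<and> R' M a)"
proof -
  obtain \<phi> where "\<phi> \<in> fmlas L k" "\<And>M a. a \<in> tuples M k \<Longrightarrow> holds M \<phi> a \<longleftrightarrow> R M a"
    using assms(1) unfolding definable_rel_def by blast
  moreover obtain \<psi> where "\<psi> \<in> fmlas L k" "\<And>M a. a \<in> tuples M k \<Longrightarrow> holds M \<psi> a \<longleftrightarrow> R' M a"
    using assms(2) unfolding definable_rel_def by blast
  ultimately show ?thesis unfolding definable_rel_def
    by (intro bexI[of _ "Conj \<phi> \<psi>"]) (auto simp: holds_def fmlas_def)
qed

lemma definable_rel_disj:
  assumes "definable_rel L k R" "definable_rel L k R'"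
  shows "definable_rel L k (\<lambda>M a. R M a \<or> R' M a)"
  by (rule definable_rel_cong[OF definable_rel_not[OF definable_rel_conj[OF
        definable_rel_not[OF assms(1)] definable_rel_not[OF assms(2)]]]]) blast

lemma definable_rel_imp:
  assumes "definable_rel L k R" "definable_rel L k R'"
  shows "definable_rel L k (\<lambda>M a. R M a \<longrightarrow> R' M a)"
  by (rule definable_rel_cong[OF definable_rel_disj[OF definable_rel_not[OF assms(1)] assms(2)]]) blast

lemma definable_rel_iff_const:
  assumes "definable_rel L k R"
  shows "definable_rel L k (\<lambda>M a. R M a \<longleftrightarrow> c)"
  using assms definable_rel_not[OF assms] by (cases c) auto

lemma definable_rel_finite_Bex:
  assumes "finite A" "\<And>i. i \<in> A \<Longrightarrow> definable_rel L k (R i)"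
  shows "definable_rel L k (\<lambda>M a. \<exists>i\<in>A. R i M a)"
  using assms
proof (induction A)
  case empty
  show ?case using definable_rel_const[of L k False] by simp
next
  case (insert i A)
  have "definable_rel L k (\<lambda>M a. R i M a \<or> (\<exists>i\<in>A. R i M a))"
    using insert by (intro definable_rel_disj) auto
  then show ?case by simp
qed

lemma definable_rel_finite_Ball:
  assumes "finite A" "\<And>i. i \<in> A \<Longrightarrow> definable_rel L k (R i)"
  shows "definable_rel L k (\<lambda>M a. \<forall>i\<in>A. R i M a)"
  by (rule definable_rel_cong[OF definable_rel_not[OF definable_rel_finite_Bex[OF assms(1),
        where R = "\<lambda>i M a. \<not> R i M a", OF definable_rel_not[OF assms(2)]]]]) auto

lemma definable_rel_subst:
  fixes R :: "('f, 'r, 'm) struct \<Rightarrow> 'm list \<Rightarrow> bool"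
  assumes "definable_rel L k R" "length js = k" "set js \<subseteq> {..<n}"
  shows "definable_rel L n (\<lambda>M a. R M (map ((!) a) js))"
proof -
  obtain \<phi> where \<phi>: "\<phi> \<in> fmlas L k" "\<And>M a. a \<in> tuples M k \<Longrightarrow> holds M \<phi> a \<longleftrightarrow> R M a"
    using assms(1) unfolding definable_rel_def by blast
  obtain \<phi>' where \<phi>': "wf_fm L \<phi>'" "fv \<phi>' \<subseteq> (!) js ` fv \<phi>"
    "\<And>(M :: ('f, 'r, 'm) struct) e. sat M e \<phi>' \<longleftrightarrow> sat M (\<lambda>u. e (js ! u)) \<phi>"
    using ex_rename[of L \<phi> "(!) js"] \<phi>(1) unfolding fmlas_def by blast
  have "\<phi>' \<in> fmlas L n"
  proof -
    have "js ! i < n" if "i \<in> fv \<phi>" for i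
      using \<phi>(1) assms(2,3) that nth_mem[of i js] unfolding fmlas_def by blast
    then show ?thesis using \<phi>'(1,2) by (auto simp: fmlas_def)
  qed
  moreover have "holds M \<phi>' a \<longleftrightarrow> R M (map ((!) a) js)" if "a \<in> tuples M n" for M a
  proof -
    have "holds M \<phi>' a \<longleftrightarrow> holds M \<phi> (map ((!) a) js)"
      unfolding holds_def \<phi>'(3)
      by (rule sat_cong) (use \<phi>(1) assms(2) in \<open>auto simp: fmlas_def\<close>)
    also have "\<dots> \<longleftrightarrow> R M (map ((!) a) js)"
      using that assms(2,3) by (intro \<phi>(2)) (auto simp: tuples_def subset_iff)
    finally show ?thesis .
  qed
  ultimately show ?thesis unfolding definable_rel_def by blast
qed

lemma definable_rel_Ex:
  fixes R :: "('f, 'r, 'm) struct \<Rightarrow> 'm list \<Rightarrow> bool"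
  assumes "definable_rel L (Suc k) R"
  shows "definable_rel L k (\<lambda>M a. \<exists>x\<in>univ M. R M (x # a))"
proof -
  \<comment> \<open>The head of the tuple is moved to variable k, so that quantifying it leaves the
    parameters at the variables below k.\<close>
  have "definable_rel L (Suc k) (\<lambda>M a. R M (map ((!) a) (k # [0..<k])))"
    by (rule definable_rel_subst[OF assms]) auto
  then obtain \<phi> where \<phi>: "\<phi> \<in> fmlas L (Suc k)"
    "\<And>M a. a \<in> tuples M (Suc k) \<Longrightarrow> holds M \<phi> a \<longleftrightarrow> R M (map ((!) a) (k # [0..<k]))"
    unfolding definable_rel_def by blast
  have "Ex k \<phi> \<in> fmlas L k"
    using \<phi>(1) by (auto simp: fmlas_def less_Suc_eq)
  moreover have "holds M (Ex k \<phi>) a \<longleftrightarrow> (\<exists>x\<in>univ M. R M (x # a))" if a: "a \<in> tuples M k" for M a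
  proof -
    have "sat M ((\<lambda>i. a ! i)(k := x)) \<phi> \<longleftrightarrow> R M (x # a)" if "x \<in> univ M" for x
    proof -
      have len: "length a = k" using a by (simp add: tuples_def)
      have "sat M ((\<lambda>i. a ! i)(k := x)) \<phi> \<longleftrightarrow> holds M \<phi> (a @ [x])"
        unfolding holds_def
        by (rule sat_cong) (use \<phi>(1) len in \<open>auto simp: fmlas_def nth_append less_Suc_eq\<close>)
      also have "\<dots> \<longleftrightarrow> R M (map ((!) (a @ [x])) (k # [0..<k]))"
        using a that by (intro \<phi>(2)) (auto simp: tuples_def)
      also have "map ((!) (a @ [x])) (k # [0..<k]) = x # a"
        using len by (auto intro!: nth_equalityI simp: nth_append)
      finally show ?thesis .
    qed
    then show ?thesis by (auto simp: holds_def)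
  qed
  ultimately show ?thesis unfolding definable_rel_def by blast
qed

lemma definable_rel_All:
  fixes R :: "('f, 'r, 'm) struct \<Rightarrow> 'm list \<Rightarrow> bool"
  assumes "definable_rel L (Suc k) R"
  shows "definable_rel L k (\<lambda>M a. \<forall>x\<in>univ M. R M (x # a))"
  by (rule definable_rel_cong[OF definable_rel_not[OF definable_rel_Ex[OF
          definable_rel_not[OF assms]]]]) auto

section \<open>Ultrafilters\<close>

lemma ex_ultrafilter_le:
  fixes F :: "'a filter"
  assumes "F \<noteq> bot"
  obtains U where "U \<le> F" "U \<noteq> bot" "\<And>P. eventually P U \<or> eventually (\<lambda>x. \<not> P x) U"
proof -
  define A where "A = {G. G \<le> F \<and> G \<noteq> bot}"
  \<comment> \<open>Finer filters are smaller, so Zorn's lemma for the reversed order yields a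
    minimal proper filter.\<close>
  have "\<exists>m\<in>A. \<forall>a\<in>A. a \<le> m \<longrightarrow> a = m"
  proof (rule predicate_Zorn)
    show "partial_order_on A (relation_of (\<lambda>x y. y \<le> x) A)"
      by (rule partial_order_on_relation_ofI) auto
    fix C assume C: "C \<in> Chains (relation_of (\<lambda>x y. y \<le> x) A)"
    then have sub: "C \<subseteq> A" and chain: "\<And>G H. G \<in> C \<Longrightarrow> H \<in> C \<Longrightarrow> G \<le> H \<or> H \<le> G"
      by (auto simp: Chains_def relation_of_def)
    show "\<exists>u\<in>A. \<forall>a\<in>C. u \<le> a"
    proof (cases "C = {}")
      case True
      then show ?thesis using assms by (auto simp: A_def)
    next
      case False
      \<comment> \<open>A property holds eventually along the infimum of a chain only if it already
        does so for a member; hence \<open>Inf C\<close> stays proper.\<close>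
      have "eventually P (Inf C) \<longleftrightarrow> (\<exists>b\<in>C. eventually P b)" for P
        by (rule eventually_Inf_base[OF False]) (metis chain inf.absorb1 inf.absorb2 order_refl)
      then have "Inf C \<noteq> bot"
        using sub by (auto simp: trivial_limit_def A_def)
      moreover have "Inf C \<le> F"
        using False sub by (auto simp: A_def intro: Inf_lower2)
      ultimately show ?thesis
        by (intro bexI[of _ "Inf C"]) (auto simp: A_def intro: Inf_lower)
    qed
  qed
  then obtain U where "U \<in> A" and max: "\<And>G. G \<in> A \<Longrightarrow> G \<le> U \<Longrightarrow> G = U" by blast
  then have U: "U \<le> F" "U \<noteq> bot" "\<And>G. G \<le> U \<Longrightarrow> G \<noteq> bot \<Longrightarrow> G = U"
    using max order_trans[of _ U F] unfolding A_def by blast+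
  have "eventually P U \<or> eventually (\<lambda>x. \<not> P x) U" for P
  proof (rule disjCI)
    assume "\<not> eventually (\<lambda>x. \<not> P x) U"
    \<comment> \<open>Unless P is refuted, restricting U to P gives a proper refinement, which by
      minimality is U itself.\<close>
    then have "inf U (principal {x. P x}) \<noteq> bot"
      by (simp add: trivial_limit_def eventually_inf_principal)
    then have "inf U (principal {x. P x}) = U" by (intro U(3)) auto
    moreover have "eventually P (inf U (principal {x. P x}))"
      by (simp add: eventually_inf_principal)
    ultimately show "eventually P U" by simp
  qed
  with U(1,2) show ?thesis by (rule that)
qed

section \<open>Alternating chains\<close>

text \<open>\<open>alternates M lt D P i x\<close> says that there are \<open>x\<^sub>1 < \<dots> < x\<^sub>i \<le> x\<close> in \<open>D\<close> on which \<open>P\<close> is alternately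
  true and false, starting with true. Comparing neighbours by \<open>\<le>\<close> suffices, since \<open>P\<close> separates them.\<close>

primrec alternates ::
  "('f, 'r, 'm) struct \<Rightarrow> 'r \<Rightarrow> ('m \<Rightarrow> bool) \<Rightarrow> ('m \<Rightarrow> bool) \<Rightarrow> nat \<Rightarrow> 'm \<Rightarrow> bool" where
  "alternates M lt D P 0 x \<longleftrightarrow> True"
| "alternates M lt D P (Suc i) x \<longleftrightarrow>
     (\<exists>z\<in>univ M. (z = x \<or> relI M lt [z, x]) \<and> D z \<and> (P z \<longleftrightarrow> even i) \<and> alternates M lt D P i z)"

definition cell :: "('f, 'r, 'm) struct \<Rightarrow> ('f, 'r) fm set \<Rightarrow> ('f, 'r) fm set \<Rightarrow> 'm \<Rightarrow> bool" where
  "cell M \<Psi> p x \<longleftrightarrow> (\<forall>\<psi>\<in>\<Psi>. holds M \<psi> [x] \<longleftrightarrow> \<psi> \<in> p)"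

definition is_linear :: "('f, 'r, 'm) struct \<Rightarrow> 'r \<Rightarrow> bool" where
  "is_linear M lt \<longleftrightarrow>
     (\<forall>a\<in>univ M. \<not> relI M lt [a, a]) \<and>
     (\<forall>a\<in>univ M. \<forall>b\<in>univ M. \<forall>c\<in>univ M.
        relI M lt [a, b] \<longrightarrow> relI M lt [b, c] \<longrightarrow> relI M lt [a, c]) \<and>
     (\<forall>a\<in>univ M. \<forall>b\<in>univ M. relI M lt [a, b] \<or> a = b \<or> relI M lt [b, a])"

lemma is_linearD:
  assumes "is_linear M lt"
  shows "a \<in> univ M \<Longrightarrow> \<not> relI M lt [a, a]"
    and "a \<in> univ M \<Longrightarrow> b \<in> univ M \<Longrightarrow> c \<in> univ M \<Longrightarrow> relI M lt [a, b] \<Longrightarrow> relI M lt [b, c] \<Longrightarrow>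
      relI M lt [a, c]"
    and "a \<in> univ M \<Longrightarrow> b \<in> univ M \<Longrightarrow> relI M lt [a, b] \<or> a = b \<or> relI M lt [b, a]"
  using assms unfolding is_linear_def by blast+

text \<open>The point x is only an upper bound of the chain, so raising it keeps the chain valid.
  This is the source of all final segments in the proof, for any \<open>D\<close> and
  \<open>P\<close>.\<close>

lemma alternates_mono:
  assumes "is_linear M lt" "x \<in> univ M" "y \<in> univ M" "relI M lt [x, y]"
    and "alternates M lt D P i x"
  shows "alternates M lt D P i y"
proof (cases i)
  case (Suc j)
  then obtain z where "z \<in> univ M" "z = x \<or> relI M lt [z, x]"
    "D z" "P z \<longleftrightarrow> even j" "alternates M lt D P j z"
    using assms(5) by auto
  moreover from this have "relI M lt [z, y]"
    using is_linearD(2)[OF assms(1), of z x y] assms(2-4) by auto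
  ultimately show ?thesis unfolding Suc by auto
qed simp

lemma alternates_pred:
  assumes "is_linear M lt" "x \<in> univ M" "alternates M lt D P (Suc i) x"
  shows "alternates M lt D P i x"
  using assms(3) alternates_mono[OF assms(1) _ assms(2)] by auto

lemma alternates_antimono:
  assumes "is_linear M lt" "x \<in> univ M" "alternates M lt D P j x" "i \<le> j"
  shows "alternates M lt D P i x"
  using assms(4,3) by (induction rule: dec_induct) (blast dest: alternates_pred[OF assms(1,2)])+

lemma alternates_cell_mono:
  assumes "alternates M lt D P i x" "\<And>x. D x \<Longrightarrow> D' x"
  shows "alternates M lt D' P i x"
  using assms(1) by (induction i arbitrary: x) (use assms(2) in auto)

text \<open>Let i be the greatest length of a chain at or below x. If \<open>P x\<close> had the
  value required of the next point, x itself would prolong the chain; hence \<open>P x\<close> has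
  the other value, which is true exactly for odd i.\<close>

lemma parity_of_alternates:
  assumes "is_linear M lt" "x \<in> univ M" "D x" "\<not> alternates M lt D P N x"
  shows "P x \<longleftrightarrow> (\<exists>i<N. odd i \<and> alternates M lt D P i x \<and> \<not> alternates M lt D P (Suc i) x)"
proof -
  have *: "P x \<longleftrightarrow> odd i" if "alternates M lt D P i x" "\<not> alternates M lt D P (Suc i) x" for i
    using that assms(2,3) by auto
  have "\<exists>i<N. alternates M lt D P i x \<and> \<not> alternates M lt D P (Suc i) x"
  proof (rule ccontr)
    assume neg: "\<not> ?thesis"
    have "alternates M lt D P i x" if "i \<le> N" for i
      using that by (induction i) (use neg in auto)
    with assms(4) show False by auto
  qed
  then show ?thesis using * by blast
qed

lemma definable_rel_cell:
  assumes "finite \<Psi>" "\<Psi> \<subseteq> fmlas L 1" "j < k"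
  shows "definable_rel L k (\<lambda>M a. cell M \<Psi> p (a ! j))"
  unfolding cell_def
proof (rule definable_rel_finite_Ball[OF assms(1)])
  fix \<psi> assume "\<psi> \<in> \<Psi>"
  then have "definable_rel L 1 (\<lambda>M. holds M \<psi>)"
    using assms(2) by (intro definable_rel_holds) auto
  from definable_rel_subst[OF this, of "[j]" k] assms(3)
  have "definable_rel L k (\<lambda>M a. holds M \<psi> [a ! j])" by simp
  then show "definable_rel L k (\<lambda>M a. holds M \<psi> [a ! j] \<longleftrightarrow> \<psi> \<in> p)"
    by (rule definable_rel_iff_const)
qed

lemma map_nth_shift:
  "length a = m + n \<Longrightarrow> map ((!) a) [m..<m + n] = drop m a"
  by (auto intro!: nth_equalityI)

lemma definable_rel_alternates:
  fixes L :: "('f, 'r) lang"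
  assumes "rarity L lt = Some 2" "finite \<Psi>" "\<Psi> \<subseteq> fmlas L 1" "\<phi> \<in> fmlas L (1 + n)"
  shows "definable_rel L (1 + n)
    (\<lambda>(M :: ('f, 'r, 'm) struct) a.
       alternates M lt (cell M \<Psi> p) (\<lambda>z. holds M \<phi> (z # tl a)) i (hd a))"
proof (induction i)
  case 0
  then show ?case using definable_rel_const[of L _ True] by simp
next
  case (Suc i)
  \<comment> \<open>Quantifying the last point z of the chain gives the tuple z, x, b; dropping
    entry 1 leaves z, b, the arguments both of \<phi> and of the shorter chain.\<close>
  let ?js = "0 # [2..<2 + n]"
  have js: "length ?js = 1 + n" "set ?js \<subseteq> {..<Suc (1 + n)}" by auto
  note IH = definable_rel_subst[OF Suc.IH js]
  note \<phi> = definable_rel_subst[OF definable_rel_holds[OF assms(4)] js]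
  let ?R = "\<lambda>(M :: ('f, 'r, 'm) struct) c. (c ! 0 = c ! 1 \<or> relI M lt [c ! 0, c ! 1]) \<and> cell M \<Psi> p (c ! 0) \<and>
    (holds M \<phi> (map ((!) c) ?js) \<longleftrightarrow> even i) \<and>
    alternates M lt (cell M \<Psi> p) (\<lambda>z. holds M \<phi> (z # tl (map ((!) c) ?js))) i (hd (map ((!) c) ?js))"
  have R: "definable_rel L (Suc (1 + n)) ?R"
    by (intro definable_rel_conj definable_rel_disj definable_rel_eq definable_rel_less
        definable_rel_cell definable_rel_iff_const IH \<phi> assms(1-3)) auto
  show ?case
  proof (rule definable_rel_cong[OF definable_rel_Ex[OF R]])
    fix M :: "('f, 'r, 'm) struct" and a assume a: "a \<in> tuples M (1 + n)"
    then obtain x b where ab: "a = x # b" "length b = n" by (cases a) (auto simp: tuples_def)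
    have "map ((!) (z # a)) ?js = z # b" for z
      using map_nth_shift[of "z # a" 2 n] ab by simp
    then show "(\<exists>z\<in>univ M. ?R M (z # a)) \<longleftrightarrow>
      alternates M lt (cell M \<Psi> p) (\<lambda>z. holds M \<phi> (z # tl a)) (Suc i) (hd a)"
      using ab by simp
  qed
qed

text \<open>All that is needed of a Boolean combination: S does not separate points with the same
  \<Psi>-type and the same position relative to E. The property passes to complements and, after
  merging \<Psi> and E, to unions, so no normal form is required. In a linear order both comparisons
  with e fail exactly at e, so points of E are told apart from their neighbours.\<close>

definition locally_constant_off ::
  "('f, 'r, 'm) struct \<Rightarrow> 'r \<Rightarrow> ('f, 'r) fm set \<Rightarrow> 'm set \<Rightarrow> 'm set \<Rightarrow> bool" where
  "locally_constant_off M lt \<Psi> E S \<longleftrightarrow>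
     (\<forall>x\<in>univ M. \<forall>y\<in>univ M. (\<forall>\<psi>\<in>\<Psi>. holds M \<psi> [x] \<longleftrightarrow> holds M \<psi> [y]) \<longrightarrow>
        (\<forall>e\<in>E. (relI M lt [e, x] \<longleftrightarrow> relI M lt [e, y]) \<and> (relI M lt [x, e] \<longleftrightarrow> relI M lt [y, e])) \<longrightarrow>
        (x \<in> S \<longleftrightarrow> y \<in> S))"

lemma locally_constant_off_mono:
  "locally_constant_off M lt \<Psi> E S \<Longrightarrow> \<Psi> \<subseteq> \<Psi>' \<Longrightarrow> E \<subseteq> E' \<Longrightarrow> locally_constant_off M lt \<Psi>' E' S"
  unfolding locally_constant_off_def subset_iff by metis

lemma bool_comb_locally_constant:
  assumes lin: "is_linear M lt"
    and "S \<in> bool_comb (univ M)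
      ({{a} | a. a \<in> univ M} \<union> intervals lt M \<union> {Z. zero_definable L M Z})"
  shows "\<exists>\<Psi> E. finite \<Psi> \<and> \<Psi> \<subseteq> fmlas L 1 \<and> finite E \<and> E \<subseteq> univ M \<and> locally_constant_off M lt \<Psi> E S"
  using assms(2)
proof induction
  case (gen A)
  then consider a where "A = {a}" "a \<in> univ M" | l u where "A = interval lt M l u"
      "set_option l \<subseteq> univ M" "set_option u \<subseteq> univ M" | "zero_definable L M A"
    unfolding intervals_def by blast
  then show ?case
  proof cases
    case 1
    then have "locally_constant_off M lt {} {a} A"
      using is_linearD(1,3)[OF lin] unfolding locally_constant_off_def by blast
    then show ?thesis using 1 by (intro exI[of _ "{}"] exI[of _ "{a}"]) auto
  next
    case 2
    then have "locally_constant_off M lt {} (set_option l \<union> set_option u) A"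
      unfolding locally_constant_off_def interval_def by (cases l; cases u) auto
    then show ?thesis using 2
      by (intro exI[of _ "{}"] exI[of _ "set_option l \<union> set_option u"]) auto
  next
    case 3
    then obtain \<psi> where "\<psi> \<in> fmlas L 1" "A = {a\<in>univ M. holds M \<psi> [a]}"
      unfolding zero_definable_def by blast
    then show ?thesis
      by (intro exI[of _ "{\<psi>}"] exI[of _ "{}"]) (auto simp: locally_constant_off_def)
  qed
next
  case (compl A)
  then show ?case by (auto simp: locally_constant_off_def)
next
  case (union A B)
  obtain \<Psi> E where A: "finite \<Psi>" "\<Psi> \<subseteq> fmlas L 1" "finite E" "E \<subseteq> univ M"
    "locally_constant_off M lt \<Psi> E A" using union.IH(1) by blast
  obtain \<Psi>' E' where B: "finite \<Psi>'" "\<Psi>' \<subseteq> fmlas L 1" "finite E'" "E' \<subseteq> univ M"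
    "locally_constant_off M lt \<Psi>' E' B" using union.IH(2) by blast
  have "locally_constant_off M lt (\<Psi> \<union> \<Psi>') (E \<union> E') A"
    "locally_constant_off M lt (\<Psi> \<union> \<Psi>') (E \<union> E') B"
    using A(5) B(5) by (auto elim: locally_constant_off_mono)
  then have "locally_constant_off M lt (\<Psi> \<union> \<Psi>') (E \<union> E') (A \<union> B)"
    unfolding locally_constant_off_def by blast
  then show ?case
    using A B by (intro exI[of _ "\<Psi> \<union> \<Psi>'"] exI[of _ "E \<union> E'"]) auto
qed

text \<open>Every e in E adds 0, 1 or 2 to \<open>pos x\<close> according to whether x < e, x = e or
  e < x. Within a cell, a change of membership in S forces \<open>pos\<close> to increase strictly.
  As \<open>pos\<close> takes at most 2 |E| + 1 values, no chain has 2 |E| + 2 points.\<close>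

lemma locally_constant_bounds_alternation:
  assumes lin: "is_linear M lt" and E: "finite E" "E \<subseteq> univ M"
    and const: "locally_constant_off M lt \<Psi> E S" and x: "x \<in> univ M"
  shows "\<not> alternates M lt (cell M \<Psi> p) (\<lambda>z. z \<in> S) (2 * card E + 2) x"
proof
  define below where "below x = {e\<in>E. relI M lt [e, x]}" for x
  define upto where "upto x = {e\<in>E. \<not> relI M lt [x, e]}" for x
  define pos where "pos x = card (below x) + card (upto x)" for x
  have fin: "finite (below x)" "finite (upto x)" for x
    using E(1) by (auto simp: below_def upto_def)
  have strict: "pos z < pos y" if "z \<in> univ M" "y \<in> univ M" "z = y \<or> relI M lt [z, y]"
    "cell M \<Psi> p z" "cell M \<Psi> p y" "z \<in> S \<longleftrightarrow> y \<notin> S" for z y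
  proof -
    have sub: "below z \<subseteq> below y" "upto z \<subseteq> upto y"
      using that(1-3) E(2) is_linearD(2)[OF lin] unfolding below_def upto_def by blast+
    have "below z \<noteq> below y \<or> upto z \<noteq> upto y"
    proof (rule ccontr)
      assume "\<not> ?thesis"
      then have "\<forall>e\<in>E. (relI M lt [e, z] \<longleftrightarrow> relI M lt [e, y]) \<and> (relI M lt [z, e] \<longleftrightarrow> relI M lt [y, e])"
        unfolding below_def upto_def by blast
      then have "z \<in> S \<longleftrightarrow> y \<in> S"
        using const that(1,2,4,5) unfolding locally_constant_off_def cell_def by blast
      with that(6) show False by blast
    qed
    then have "below z \<subset> below y \<or> upto z \<subset> upto y" using sub by blast
    then have "card (below z) < card (below y) \<or> card (upto z) < card (upto y)"
      using psubset_card_mono[OF fin(1)] psubset_card_mono[OF fin(2)] by blast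
    moreover have "card (below z) \<le> card (below y)" "card (upto z) \<le> card (upto y)"
      using card_mono[OF fin(1) sub(1)] card_mono[OF fin(2) sub(2)] .
    ultimately show ?thesis unfolding pos_def by linarith
  qed
  \<comment> \<open>Here y is itself the point number i + 1 of the chain, so i strict increases lie
    before it.\<close>
  have *: "i \<le> pos y" if "y \<in> univ M" "cell M \<Psi> p y" "y \<in> S \<longleftrightarrow> even i"
    "alternates M lt (cell M \<Psi> p) (\<lambda>z. z \<in> S) i y" for i y
    using that
  proof (induction i arbitrary: y)
    case (Suc i)
    then obtain z where z: "z \<in> univ M" "z = y \<or> relI M lt [z, y]" "cell M \<Psi> p z"
      "z \<in> S \<longleftrightarrow> even i" "alternates M lt (cell M \<Psi> p) (\<lambda>z. z \<in> S) i z" by auto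
    then have "i \<le> pos z" using Suc.IH by blast
    also have "pos z < pos y"
      using z Suc.prems by (intro strict) auto
    finally show ?case by simp
  qed simp
  have "pos y \<le> 2 * card E" for y
    using card_mono[of E "below y"] card_mono[of E "upto y"] E(1)
    unfolding pos_def by (auto simp: below_def upto_def)
  moreover assume "alternates M lt (cell M \<Psi> p) (\<lambda>z. z \<in> S) (2 * card E + 2) x"
  then obtain z where "z \<in> univ M" "cell M \<Psi> p z" "z \<in> S \<longleftrightarrow> even (2 * card E + 1)"
    "alternates M lt (cell M \<Psi> p) (\<lambda>z. z \<in> S) (2 * card E + 1) z"
    unfolding add_2_eq_Suc' alternates.simps by auto
  from *[OF this] have "2 * card E + 1 \<le> pos z" .
  ultimately show False by (metis add_leD1 add_le_same_cancel1 le_trans not_one_le_zero)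
qed

section \<open>Skolem hulls in ultrapowers\<close>

text \<open>A Skolem term denotes a function of a tuple of parameters, namely of a generic tuple in the
  ultrapower. Terms can be coded injectively by formulas, so the hull generated by the tuple fits into any
  type that contains the formulas: this replaces the downward Loewenheim-Skolem theorem.\<close>

datatype ('f, 'r) skolem = Param nat | Witness "('f, 'r) fm" nat "('f, 'r) skolem list"

fun wf_skolem :: "('f, 'r) lang \<Rightarrow> nat \<Rightarrow> ('f, 'r) skolem \<Rightarrow> bool" where
  "wf_skolem L n (Param i) \<longleftrightarrow> i < n"
| "wf_skolem L n (Witness \<phi> v ts) \<longleftrightarrow> wf_fm L \<phi> \<and> (\<forall>t\<in>set ts. wf_skolem L n t)"

text \<open>The implication makes the choice total: if there is no witness, an arbitrary element of
  the universe is taken, so values never leave \<open>univ M\<close>.\<close>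

fun skolem_val :: "('f, 'r, 'm) struct \<Rightarrow> 'm list \<Rightarrow> ('f, 'r) skolem \<Rightarrow> 'm" where
  "skolem_val M b (Param i) = b ! i"
| "skolem_val M b (Witness \<phi> v ts) =
     (SOME x. x \<in> univ M \<and>
        ((\<exists>y\<in>univ M. sat M (((!) (map (skolem_val M b) ts))(v := y)) \<phi>) \<longrightarrow>
          sat M (((!) (map (skolem_val M b) ts))(v := x)) \<phi>))"

text \<open>The meaning of the code is irrelevant; it has to be injective and well-formed, as
  \<open>h\<close> is injective on well-formed formulas only. The outermost \<open>Ex\<close> or
  \<open>Conj\<close> shows the constructor, and a list becomes nested conjunctions closed by an
  equation.\<close>

fun skolem_code :: "('f, 'r) skolem \<Rightarrow> ('f, 'r) fm" where
  "skolem_code (Param i) = Ex i (Eq (Var 0) (Var 0))"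
| "skolem_code (Witness \<phi> v ts) =
     Conj \<phi> (Ex v (foldr (\<lambda>t. Conj (skolem_code t)) ts (Eq (Var 0) (Var 0))))"

lemma foldr_Conj_inject:
  assumes "foldr (\<lambda>t. Conj (f t)) ts (Eq (Var 0) (Var 0)) = foldr (\<lambda>t. Conj (f t)) ss (Eq (Var 0) (Var 0))"
    and "\<And>t s. t \<in> set ts \<Longrightarrow> f t = f s \<Longrightarrow> t = s"
  shows "ts = ss"
  using assms
proof (induction ts arbitrary: ss)
  case Nil
  then show ?case by (cases ss) auto
next
  case (Cons t ts)
  then show ?case by (cases ss) auto
qed

lemma skolem_code_inject: "skolem_code t = skolem_code s \<Longrightarrow> t = s"
proof (induction t arbitrary: s)
  case (Param i)
  then show ?case by (cases s) auto
next
  case (Witness \<phi> v ts)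
  then obtain ss where s: "s = Witness \<phi> v ss" by (cases s) auto
  with Witness.prems have
    "foldr (\<lambda>t. Conj (skolem_code t)) ts (Eq (Var 0) (Var 0)) =
     foldr (\<lambda>t. Conj (skolem_code t)) ss (Eq (Var 0) (Var 0))" by simp
  then have "ts = ss" by (rule foldr_Conj_inject) (rule Witness.IH)
  with s show ?case by simp
qed

lemma wf_skolem_code: "wf_skolem L n t \<Longrightarrow> wf_fm L (skolem_code t)"
proof (induction t)
  case (Witness \<phi> v ts)
  have "wf_fm L (foldr (\<lambda>t. Conj (skolem_code t)) ts (Eq (Var 0) (Var 0)))"
    using Witness by (induction ts) auto
  then show ?case using Witness.prems by simp
qed simp

lemma skolem_val_Witness:
  assumes "univ M \<noteq> {}"
  shows "skolem_val M b (Witness \<phi> v ts) \<in> univ M"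
    and "y \<in> univ M \<Longrightarrow> sat M (((!) (map (skolem_val M b) ts))(v := y)) \<phi> \<Longrightarrow>
      sat M (((!) (map (skolem_val M b) ts))(v := skolem_val M b (Witness \<phi> v ts))) \<phi>"
proof -
  let ?P = "\<lambda>x. x \<in> univ M \<and>
        ((\<exists>y\<in>univ M. sat M (((!) (map (skolem_val M b) ts))(v := y)) \<phi>) \<longrightarrow>
          sat M (((!) (map (skolem_val M b) ts))(v := x)) \<phi>)"
  have "\<exists>x. ?P x" using assms by blast
  then have "?P (SOME x. ?P x)" by (rule someI_ex)
  then have "?P (skolem_val M b (Witness \<phi> v ts))" by simp
  then show "skolem_val M b (Witness \<phi> v ts) \<in> univ M"
    and "y \<in> univ M \<Longrightarrow> sat M (((!) (map (skolem_val M b) ts))(v := y)) \<phi> \<Longrightarrow>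
      sat M (((!) (map (skolem_val M b) ts))(v := skolem_val M b (Witness \<phi> v ts))) \<phi>"
    by blast+
qed

lemma skolem_val_in_univ:
  assumes "univ M \<noteq> {}" "b \<in> tuples M n" "wf_skolem L n t"
  shows "skolem_val M b t \<in> univ M"
proof (cases t)
  case (Param i)
  then show ?thesis using assms(2,3) by (auto simp: tuples_def)
next
  case (Witness \<phi> v ts)
  then show ?thesis using skolem_val_Witness(1)[OF assms(1)] by blast
qed

text \<open>Function symbols need no constructor of their own: f(ts) is the only witness of an
  equation y = f(..), with y the first variable not occupied by an argument.\<close>

definition app_skolem :: "'f \<Rightarrow> ('f, 'r) skolem list \<Rightarrow> ('f, 'r) skolem" where
  "app_skolem f ts =
     Witness (Eq (Var (length ts)) (App f (map Var [0..<length ts]))) (length ts) ts"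

lemma wf_app_skolem:
  assumes "farity L f = Some (length ts)" "\<And>t. t \<in> set ts \<Longrightarrow> wf_skolem L n t"
  shows "wf_skolem L n (app_skolem f ts)"
  using assms by (auto simp: app_skolem_def)

lemma skolem_val_app_skolem:
  assumes "is_struct L M" "b \<in> tuples M n" "farity L f = Some (length ts)"
    "\<And>t. t \<in> set ts \<Longrightarrow> wf_skolem L n t"
  shows "skolem_val M b (app_skolem f ts) = funI M f (map (skolem_val M b) ts)"
proof -
  let ?xs = "map (skolem_val M b) ts" and ?k = "length ts"
  let ?\<phi> = "Eq (Var ?k) (App f (map Var [0..<?k]))"
  have ne: "univ M \<noteq> {}" using assms(1) by (simp add: is_struct_def)
  have "?xs \<in> tuples M ?k"
    using skolem_val_in_univ[OF ne assms(2)] assms(4) by (auto simp: tuples_def)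
  then have y: "funI M f ?xs \<in> univ M"
    using assms(1,3) unfolding is_struct_def by blast
  have "map (eval M (((!) ?xs)(?k := y))) (map Var [0..<?k]) = ?xs" for y
    by (auto intro!: nth_equalityI)
  then have sat: "sat M (((!) ?xs)(?k := y)) ?\<phi> \<longleftrightarrow> y = funI M f ?xs" for y
    by (simp del: map_map)
  show ?thesis
    using skolem_val_Witness(2)[OF ne y, of b ts ?k ?\<phi>] unfolding sat app_skolem_def by blast
qed

text \<open>The index set of the ultrapower consists of the parameter tuples themselves. The
  identity then represents the generic tuple, with coordinates \<open>Param i\<close>, and what
  holds of it is what holds for \<open>U\<close>-almost every b.\<close>

locale skolem_ultrapower =
  fixes L :: "('f, 'r) lang" and M :: "('f, 'r, 'm) struct" and n :: nat
    and U :: "'m list filter" and h :: "('f, 'r) fm \<Rightarrow> 'm"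
  assumes is_struct: "is_struct L M"
    and tuples: "\<forall>\<^sub>F b in U. b \<in> tuples M n"
    and nontrivial: "U \<noteq> bot"
    and ultra: "eventually P U \<or> eventually (\<lambda>b. \<not> P b) U"
    and inj_h: "inj_on h {\<phi>. wf_fm L \<phi>}"
begin

abbreviation W :: "('f, 'r) skolem set" where
  "W \<equiv> {t. wf_skolem L n t}"

definition equiv :: "('f, 'r) skolem \<Rightarrow> ('f, 'r) skolem \<Rightarrow> bool" where
  "equiv t s \<longleftrightarrow> (\<forall>\<^sub>F b in U. skolem_val M b t = skolem_val M b s)"

text \<open>The class of t modulo \<open>U\<close>, turned into an element of \<open>'m\<close>.
  Coding a representative that depends only on the class makes equivalent terms denote the same
  element.\<close>

definition elem :: "('f, 'r) skolem \<Rightarrow> 'm" where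
  "elem t = h (skolem_code (SOME s. s \<in> W \<and> equiv t s))"

definition repr :: "'m \<Rightarrow> ('f, 'r) skolem" where
  "repr a = (SOME t. t \<in> W \<and> elem t = a)"

definition skolem_hull :: "('f, 'r, 'm) struct" where
  "skolem_hull = \<lparr>univ = elem ` W,
     funI = \<lambda>f as. elem (app_skolem f (map repr as)),
     relI = \<lambda>R as. \<forall>\<^sub>F b in U. relI M R (map (\<lambda>a. skolem_val M b (repr a)) as)\<rparr>"

lemma univ_skolem_hull: "univ skolem_hull = elem ` W"
  by (simp add: skolem_hull_def)

lemma eventually_not: "(\<forall>\<^sub>F b in U. \<not> P b) \<longleftrightarrow> \<not> (\<forall>\<^sub>F b in U. P b)"
proof
  assume "\<forall>\<^sub>F b in U. \<not> P b"
  show "\<not> (\<forall>\<^sub>F b in U. P b)"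
  proof
    assume "\<forall>\<^sub>F b in U. P b"
    with \<open>\<forall>\<^sub>F b in U. \<not> P b\<close> have "\<forall>\<^sub>F b in U. False" by eventually_elim simp
    with nontrivial show False by (simp add: trivial_limit_def)
  qed
qed (use ultra in blast)

lemma equiv_refl: "equiv t t"
  by (simp add: equiv_def)

lemma equiv_sym: "equiv t s \<Longrightarrow> equiv s t"
  by (simp add: equiv_def eq_commute)

lemma equiv_trans: "equiv t s \<Longrightarrow> equiv s r \<Longrightarrow> equiv t r"
  unfolding equiv_def by (erule (1) eventually_elim2) simp

lemma elem_eq_iff:
  assumes "t \<in> W" "s \<in> W"
  shows "elem t = elem s \<longleftrightarrow> equiv t s"
proof -
  define r where "r t = (SOME s. s \<in> W \<and> equiv t s)" for t
  have r: "r t \<in> W \<and> equiv t (r t)" if "t \<in> W" for t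
    unfolding r_def by (rule someI[of _ t]) (use that equiv_refl in auto)
  have "elem t = elem s \<longleftrightarrow> r t = r s"
  proof
    assume "elem t = elem s"
    then have "skolem_code (r t) = skolem_code (r s)"
      unfolding elem_def r_def[symmetric]
      by (rule inj_onD[OF inj_h]) (use r[OF assms(1)] r[OF assms(2)] wf_skolem_code in auto)
    then show "r t = r s" by (rule skolem_code_inject)
  qed (simp add: elem_def r_def)
  also have "\<dots> \<longleftrightarrow> equiv t s"
  proof
    assume "equiv t s"
    then have "equiv t = equiv s" using equiv_sym equiv_trans by blast
    then show "r t = r s" unfolding r_def by simp
  next
    assume "r t = r s"
    then show "equiv t s" using r[OF assms(1)] r[OF assms(2)] equiv_sym equiv_trans by metis
  qed
  finally show ?thesis .
qed

lemma repr_elem: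
  assumes "t \<in> W"
  shows "repr (elem t) \<in> W" "equiv (repr (elem t)) t"
proof -
  have "repr (elem t) \<in> W \<and> elem (repr (elem t)) = elem t"
    unfolding repr_def by (rule someI[of _ t]) (use assms in auto)
  then show "repr (elem t) \<in> W" "equiv (repr (elem t)) t"
    using elem_eq_iff assms by auto
qed

lemma eventually_map_repr:
  assumes "\<And>t. t \<in> set ts \<Longrightarrow> g t \<in> W \<and> (\<forall>\<^sub>F b in U. skolem_val M b (g t) = v b t)"
  shows "\<forall>\<^sub>F b in U. map (\<lambda>a. skolem_val M b (repr a)) (map (\<lambda>t. elem (g t)) ts) = map (v b) ts"
proof -
  have "\<forall>\<^sub>F b in U. skolem_val M b (repr (elem (g t))) = v b t" if "t \<in> set ts" for t
  proof -
    have "\<forall>\<^sub>F b in U. skolem_val M b (g t) = v b t" "equiv (repr (elem (g t))) (g t)"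
      using assms[OF that] repr_elem(2) by blast+
    then show ?thesis unfolding equiv_def by eventually_elim simp
  qed
  then have "\<forall>\<^sub>F b in U. \<forall>t\<in>set ts. skolem_val M b (repr (elem (g t))) = v b t"
    by (intro eventually_ball_finite) auto
  then show ?thesis by eventually_elim simp
qed

lemma eval_hull:
  assumes "wf_trm L \<tau>" "\<And>i. E i \<in> W"
  shows "\<exists>t. t \<in> W \<and> (\<forall>\<^sub>F b in U. skolem_val M b t = eval M (\<lambda>i. skolem_val M b (E i)) \<tau>) \<and>
    eval skolem_hull (\<lambda>i. elem (E i)) \<tau> = elem t"
  using assms(1)
proof (induction \<tau>)
  case (Var v)
  show ?case using assms(2) by (intro exI[of _ "E v"]) auto
next
  case (App f ts)
  let ?v = "\<lambda>b. eval M (\<lambda>i. skolem_val M b (E i))"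
  have "\<forall>\<tau>\<in>set ts. \<exists>t. t \<in> W \<and> (\<forall>\<^sub>F b in U. skolem_val M b t = ?v b \<tau>) \<and>
    eval skolem_hull (\<lambda>i. elem (E i)) \<tau> = elem t"
    using App by auto
  from bchoice[OF this] obtain g where g: "\<And>\<tau>. \<tau> \<in> set ts \<Longrightarrow> g \<tau> \<in> W \<and> (\<forall>\<^sub>F b in U. skolem_val M b (g \<tau>) = ?v b \<tau>)"
    and eval: "\<And>\<tau>. \<tau> \<in> set ts \<Longrightarrow> eval skolem_hull (\<lambda>i. elem (E i)) \<tau> = elem (g \<tau>)"
    by blast
  let ?as = "map (\<lambda>\<tau>. elem (g \<tau>)) ts"
  let ?t = "app_skolem f (map repr ?as)"
  have wf: "farity L f = Some (length (map repr ?as))" "\<And>t. t \<in> set (map repr ?as) \<Longrightarrow> wf_skolem L n t"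
    using App.prems g repr_elem(1) by auto
  have args: "\<forall>\<^sub>F b in U. map (\<lambda>a. skolem_val M b (repr a)) ?as = map (?v b) ts"
    by (rule eventually_map_repr) (rule g)
  have "map (eval skolem_hull (\<lambda>i. elem (E i))) ts = ?as"
    using eval by simp
  then have "eval skolem_hull (\<lambda>i. elem (E i)) (App f ts) = elem ?t"
    by (simp add: skolem_hull_def del: map_map map_eq_conv)
  moreover have "?t \<in> W" using wf_app_skolem[OF wf] by simp
  moreover have "\<forall>\<^sub>F b in U. skolem_val M b ?t = ?v b (App f ts)"
    using tuples args
  proof eventually_elim
    case (elim b)
    have "skolem_val M b ?t = funI M f (map (skolem_val M b) (map repr ?as))"
      by (rule skolem_val_app_skolem[OF is_struct elim(1) wf])
    also have "map (skolem_val M b) (map repr ?as) = map (?v b) ts"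
      using elim(2) by (simp add: comp_def)
    finally show ?case by simp
  qed
  ultimately show ?case by blast
qed

theorem Los:
  assumes "wf_fm L \<phi>" "\<And>i. E i \<in> W"
  shows "sat skolem_hull (\<lambda>i. elem (E i)) \<phi> \<longleftrightarrow> (\<forall>\<^sub>F b in U. sat M (\<lambda>i. skolem_val M b (E i)) \<phi>)"
  using assms
proof (induction \<phi> arbitrary: E)
  case (Eq s t)
  let ?v = "\<lambda>b. eval M (\<lambda>i. skolem_val M b (E i))"
  obtain s' where s: "s' \<in> W" "\<forall>\<^sub>F b in U. skolem_val M b s' = ?v b s"
    "eval skolem_hull (\<lambda>i. elem (E i)) s = elem s'"
    using eval_hull[of s E] Eq by auto
  obtain t' where t: "t' \<in> W" "\<forall>\<^sub>F b in U. skolem_val M b t' = ?v b t"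
    "eval skolem_hull (\<lambda>i. elem (E i)) t = elem t'"
    using eval_hull[of t E] Eq by auto
  have "sat skolem_hull (\<lambda>i. elem (E i)) (Eq s t) \<longleftrightarrow> equiv s' t'"
    using s t elem_eq_iff by simp
  also have "\<dots> \<longleftrightarrow> (\<forall>\<^sub>F b in U. ?v b s = ?v b t)"
    unfolding equiv_def
    by (rule eventually_cong[OF eventually_conj[OF s(2) t(2)]]) auto
  finally show ?case by simp
next
  case (Rel R ts)
  let ?v = "\<lambda>b. eval M (\<lambda>i. skolem_val M b (E i))"
  have "\<forall>\<tau>\<in>set ts. \<exists>t. t \<in> W \<and> (\<forall>\<^sub>F b in U. skolem_val M b t = ?v b \<tau>) \<and>
    eval skolem_hull (\<lambda>i. elem (E i)) \<tau> = elem t"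
    using Rel.prems eval_hull by simp
  from bchoice[OF this] obtain g where g: "\<And>\<tau>. \<tau> \<in> set ts \<Longrightarrow> g \<tau> \<in> W \<and> (\<forall>\<^sub>F b in U. skolem_val M b (g \<tau>) = ?v b \<tau>)"
    and eval: "\<And>\<tau>. \<tau> \<in> set ts \<Longrightarrow> eval skolem_hull (\<lambda>i. elem (E i)) \<tau> = elem (g \<tau>)"
    by blast
  let ?as = "map (\<lambda>\<tau>. elem (g \<tau>)) ts"
  have args: "\<forall>\<^sub>F b in U. map (\<lambda>a. skolem_val M b (repr a)) ?as = map (?v b) ts"
    by (rule eventually_map_repr) (rule g)
  have "map (eval skolem_hull (\<lambda>i. elem (E i))) ts = ?as"
    using eval by simp
  then have "sat skolem_hull (\<lambda>i. elem (E i)) (Rel R ts) \<longleftrightarrow>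
    (\<forall>\<^sub>F b in U. relI M R (map (\<lambda>a. skolem_val M b (repr a)) ?as))"
    by (simp add: skolem_hull_def del: map_map map_eq_conv)
  also have "\<dots> \<longleftrightarrow> (\<forall>\<^sub>F b in U. relI M R (map (?v b) ts))"
    by (rule eventually_cong[OF args]) (rule arg_cong)
  finally show ?case by simp
next
  case (Neg \<phi>)
  then show ?case by (simp add: eventually_not)
next
  case (Conj \<phi> \<psi>)
  then show ?case by (simp add: eventually_conj_iff)
next
  case (Ex v \<phi>)
  have upd: "(\<lambda>i. skolem_val M b ((E(v := t)) i)) = (\<lambda>i. skolem_val M b (E i))(v := skolem_val M b t)"
    for b t by auto
  have step: "sat skolem_hull ((\<lambda>i. elem (E i))(v := elem t)) \<phi> \<longleftrightarrow>
    (\<forall>\<^sub>F b in U. sat M ((\<lambda>i. skolem_val M b (E i))(v := skolem_val M b t)) \<phi>)" if "t \<in> W" for t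
  proof -
    have "(\<lambda>i. elem (E i))(v := elem t) = (\<lambda>i. elem ((E(v := t)) i))" by auto
    then show ?thesis using Ex.IH[of "E(v := t)"] Ex.prems that unfolding upd by simp
  qed
  have ne: "univ M \<noteq> {}" using is_struct by (simp add: is_struct_def)
  show ?case
  proof
    assume "sat skolem_hull (\<lambda>i. elem (E i)) (Ex v \<phi>)"
    then obtain t where t: "t \<in> W" "sat skolem_hull ((\<lambda>i. elem (E i))(v := elem t)) \<phi>"
      by (auto simp: skolem_hull_def)
    from tuples step[OF t(1), THEN iffD1, OF t(2)]
    show "\<forall>\<^sub>F b in U. sat M (\<lambda>i. skolem_val M b (E i)) (Ex v \<phi>)"
    proof eventually_elim
      case (elim b)
      then show ?case using skolem_val_in_univ[OF ne elim(1)] t(1) by auto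
    qed
  next
    assume ex: "\<forall>\<^sub>F b in U. sat M (\<lambda>i. skolem_val M b (E i)) (Ex v \<phi>)"
    obtain k where k: "fv \<phi> \<subseteq> {..<k}"
      using finite_nat_iff_bounded finite_fv by blast
    \<comment> \<open>A Skolem term takes a finite list of arguments; the variables below k are all
      that \<phi> can see of the assignment. The term \<open>?t\<close> picks witnesses
      simultaneously for all b, so the hull is closed under existential witnesses.\<close>
    let ?ts = "map E [0..<k]"
    let ?t = "Witness \<phi> v ?ts"
    have t: "?t \<in> W" using Ex.prems by auto
    have cong: "sat M (((!) (map (skolem_val M b) ?ts))(v := y)) \<phi> \<longleftrightarrow>
      sat M ((\<lambda>i. skolem_val M b (E i))(v := y)) \<phi>" for b y
      by (rule sat_cong) (use k in auto)
    from ex have "\<forall>\<^sub>F b in U. sat M ((\<lambda>i. skolem_val M b (E i))(v := skolem_val M b ?t)) \<phi>"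
    proof eventually_elim
      case (elim b)
      then obtain y where "y \<in> univ M" "sat M ((\<lambda>i. skolem_val M b (E i))(v := y)) \<phi>" by auto
      then show ?case using skolem_val_Witness(2)[OF ne, of y b ?ts v \<phi>] unfolding cong by blast
    qed
    then have "sat skolem_hull ((\<lambda>i. elem (E i))(v := elem ?t)) \<phi>"
      using step[OF t] by blast
    then show "sat skolem_hull (\<lambda>i. elem (E i)) (Ex v \<phi>)"
      using t unfolding sat.simps univ_skolem_hull by blast
  qed
qed

lemma W_nonempty: "\<exists>t. t \<in> W"
  by (rule exI[of _ "Witness (Eq (Var 0) (Var 0)) 0 []"]) simp

lemma holds_hull:
  assumes "\<phi> \<in> fmlas L (length ts)" "set ts \<subseteq> W"
  shows "holds skolem_hull \<phi> (map elem ts) \<longleftrightarrow> (\<forall>\<^sub>F b in U. holds M \<phi> (map (skolem_val M b) ts))"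
proof -
  obtain t0 where t0: "t0 \<in> W" using W_nonempty by blast
  \<comment> \<open>Entries beyond the end of a list are unspecified, whereas \<open>Los\<close>
    needs every variable to denote an element of the hull; the padding \<open>t0\<close> is never
    seen by \<phi>.\<close>
  define E where "E i = (if i < length ts then ts ! i else t0)" for i
  have E: "E i \<in> W" for i
    using assms(2) t0 nth_mem[of i ts] unfolding E_def by (auto simp del: nth_mem)
  have "holds skolem_hull \<phi> (map elem ts) \<longleftrightarrow> sat skolem_hull (\<lambda>i. elem (E i)) \<phi>"
    unfolding holds_def by (rule sat_cong) (use assms(1) in \<open>auto simp: fmlas_def E_def\<close>)
  also have "\<dots> \<longleftrightarrow> (\<forall>\<^sub>F b in U. sat M (\<lambda>i. skolem_val M b (E i)) \<phi>)"
    using assms(1) E by (intro Los) (auto simp: fmlas_def)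
  also have "\<dots> \<longleftrightarrow> (\<forall>\<^sub>F b in U. holds M \<phi> (map (skolem_val M b) ts))"
  proof (rule eventually_cong[OF always_eventually])
    show "sat M (\<lambda>i. skolem_val M b (E i)) \<phi> \<longleftrightarrow> holds M \<phi> (map (skolem_val M b) ts)" for b
      unfolding holds_def by (rule sat_cong) (use assms(1) in \<open>auto simp: fmlas_def E_def\<close>)
  qed auto
  finally show ?thesis .
qed

lemma hull_is_struct: "is_struct L skolem_hull"
  unfolding is_struct_def
proof (intro conjI allI impI ballI)
  show "univ skolem_hull \<noteq> {}" using W_nonempty by (auto simp: skolem_hull_def)
next
  fix f k as assume fk: "farity L f = Some k" "as \<in> tuples skolem_hull k"
  have "repr a \<in> W" if "a \<in> set as" for a
    using that fk(2) repr_elem(1) by (auto simp: tuples_def skolem_hull_def)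
  then have "app_skolem f (map repr as) \<in> W"
    using fk wf_app_skolem[of L f "map repr as" n] by (auto simp: tuples_def)
  then show "funI skolem_hull f as \<in> univ skolem_hull" by (simp add: skolem_hull_def)
qed

lemma hull_models:
  assumes "M \<in> models L T" "T \<subseteq> sentences L"
  shows "skolem_hull \<in> models L T"
proof -
  have "holds skolem_hull \<sigma> []" if "\<sigma> \<in> T" for \<sigma>
    using holds_hull[of \<sigma> "[]"] that assms by (auto simp: models_def)
  then show ?thesis using hull_is_struct by (simp add: models_def)
qed

definition generic :: "'m list" where
  "generic = map elem (map Param [0..<n])"

lemma generic_tuple: "generic \<in> tuples skolem_hull n"
  by (auto simp: generic_def tuples_def skolem_hull_def)

lemma holds_generic:
  assumes "\<phi> \<in> fmlas L n"
  shows "holds skolem_hull \<phi> generic \<longleftrightarrow> (\<forall>\<^sub>F b in U. holds M \<phi> b)"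
proof -
  have "holds skolem_hull \<phi> generic \<longleftrightarrow>
    (\<forall>\<^sub>F b in U. holds M \<phi> (map (skolem_val M b) (map Param [0..<n])))"
    unfolding generic_def using assms by (intro holds_hull) auto
  also have "\<dots> \<longleftrightarrow> (\<forall>\<^sub>F b in U. holds M \<phi> b)"
  proof (rule eventually_cong[OF tuples])
    fix b assume "b \<in> tuples M n"
    then have "map (skolem_val M b) (map Param [0..<n]) = b"
      by (auto simp: tuples_def intro!: nth_equalityI)
    then show "holds M \<phi> (map (skolem_val M b) (map Param [0..<n])) \<longleftrightarrow> holds M \<phi> b" by metis
  qed
  finally show ?thesis .
qed

end

section \<open>A uniform bound on alternations\<close>

lemma alternates_cong:
  assumes "\<And>z. z \<in> univ M \<Longrightarrow> P z \<longleftrightarrow> Q z"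
  shows "alternates M lt D P i x \<longleftrightarrow> alternates M lt D Q i x"
  by (induction i arbitrary: x) (auto simp: assms)

lemma cell_Int: "cell M \<Psi> (p \<inter> \<Psi>) = cell M \<Psi> p"
  by (auto simp: cell_def fun_eq_iff)

lemma models_is_linear:
  assumes "extends_theory TYPE('m) L T (infinite_linear_order_axioms lt)"
    and "(M :: ('f, 'r, 'm) struct) \<in> models L T"
  shows "is_linear M lt" "infinite (univ M)"
proof -
  have "\<forall>\<sigma>\<in>infinite_linear_order_axioms lt. holds M \<sigma> []"
    using assms unfolding extends_theory_def entails_def by blast
  then show "is_linear M lt" "infinite (univ M)"
    unfolding holds_infinite_linear_order_axioms is_linear_def by blast+
qed

text \<open>This is the compactness step. The generic tuple of the hull would be bad for all pairs
  (\<Psi>, N), while quasi-o-minimality of the hull exhibits a pair for which it is not.\<close>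

lemma uniform_alternation_bound:
  fixes L :: "('f, 'r) lang" and M :: "('f, 'r, 'm) struct"
  assumes inj_h: "inj_on (h :: ('f, 'r) fm \<Rightarrow> 'm) {\<phi>. wf_fm L \<phi>}"
    and lt: "rarity L lt = Some 2" and T: "T \<subseteq> sentences L"
    and order: "extends_theory TYPE('m) L T (infinite_linear_order_axioms lt)"
    and qom: "quasi_o_minimal TYPE('m) L lt T"
    and M: "M \<in> models L T" and \<phi>: "\<phi> \<in> fmlas L (1 + n)"
  shows "\<exists>\<Psi> N. finite \<Psi> \<and> \<Psi> \<subseteq> fmlas L 1 \<and> (\<forall>b\<in>tuples M n. \<forall>p. \<forall>x\<in>univ M.
    \<not> alternates M lt (cell M \<Psi> p) (\<lambda>z. holds M \<phi> (z # b)) N x)"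
proof (rule ccontr)
  assume unbounded: "\<not> ?thesis"
  \<comment> \<open>K says that b is bad for (\<Psi>, N). Restricting p to subsets of \<Psi> makes
    the choice of a cell a finite disjunction, so that K is first-order; \<open>cell_Int\<close>
    shows that no cell is lost.\<close>
  define K where "K \<Psi> N M' b \<longleftrightarrow> (\<exists>p\<in>Pow \<Psi>. \<exists>x\<in>univ M'.
      alternates M' lt (cell M' \<Psi> p) (\<lambda>z. holds M' \<phi> (z # b)) N x)"
    for \<Psi> N and M' :: "('f, 'r, 'm) struct" and b
  define I where "I = {\<Psi>. finite \<Psi> \<and> \<Psi> \<subseteq> fmlas L 1} \<times> (UNIV :: nat set)"
  define X where "X i = {b \<in> tuples M n. K (fst i) (snd i) M b}" for i
  define F where "F = (INF i\<in>I. principal (X i))"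
  have lin: "is_linear M lt" by (rule models_is_linear(1)[OF order M])
  have X_nonempty: "X i \<noteq> {}" if mem: "i \<in> I" for i
  proof -
    obtain \<Psi> N where i: "i = (\<Psi>, N)" "finite \<Psi>" "\<Psi> \<subseteq> fmlas L 1"
      using mem by (auto simp: I_def)
    obtain b p x where b: "b \<in> tuples M n" "x \<in> univ M"
      "alternates M lt (cell M \<Psi> p) (\<lambda>z. holds M \<phi> (z # b)) N x"
      using unbounded i(2,3) by blast
    then have "alternates M lt (cell M \<Psi> (p \<inter> \<Psi>)) (\<lambda>z. holds M \<phi> (z # b)) N x"
      by (simp only: cell_Int)
    then have "b \<in> X i" using b(1,2) unfolding X_def K_def i(1) by auto
    then show ?thesis by blast
  qed
  \<comment> \<open>Enlarging \<Psi> refines the cells and enlarging N asks for longer chains, so a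
    union of the \<Psi> and a maximum of the N bound two pairs. The sets \<open>X i\<close>
    therefore form a filter base.\<close>
  have K_mono: "K \<Psi> N M b" if K: "K \<Psi>' N' M b" and le: "\<Psi> \<subseteq> \<Psi>'" "N \<le> N'" for \<Psi> \<Psi>' N N' b
  proof -
    obtain p x where x: "x \<in> univ M"
      "alternates M lt (cell M \<Psi>' p) (\<lambda>z. holds M \<phi> (z # b)) N' x"
      using K unfolding K_def by blast
    then have "alternates M lt (cell M \<Psi>' p) (\<lambda>z. holds M \<phi> (z # b)) N x"
      using alternates_antimono[OF lin] le(2) by blast
    then have "alternates M lt (cell M \<Psi> (p \<inter> \<Psi>)) (\<lambda>z. holds M \<phi> (z # b)) N x"
      by (rule alternates_cell_mono) (use le(1) in \<open>auto simp: cell_def\<close>)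
    then show ?thesis unfolding K_def using x(1) by blast
  qed
  have ev_F: "eventually P F \<longleftrightarrow> (\<exists>i\<in>I. eventually P (principal (X i)))" for P
    unfolding F_def
  proof (rule eventually_INF_base)
    show "I \<noteq> {}" by (auto simp: I_def)
    fix i j assume ij: "i \<in> I" "j \<in> I"
    let ?k = "(fst i \<union> fst j, max (snd i) (snd j))"
    have "?k \<in> I" using ij by (auto simp: I_def)
    moreover have "X ?k \<subseteq> X i" "X ?k \<subseteq> X j"
      unfolding X_def by (auto elim: K_mono)
    ultimately show "\<exists>k\<in>I. principal (X k) \<le> inf (principal (X i)) (principal (X j))"
      by (intro bexI[of _ ?k]) auto
  qed
  have "F \<noteq> bot"
    unfolding trivial_limit_def ev_F using X_nonempty by (auto simp: eventually_principal)
  then obtain U where U: "U \<le> F" "U \<noteq> bot" "\<And>P. eventually P U \<or> eventually (\<lambda>x. \<not> P x) U"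
    using ex_ultrafilter_le by blast
  have ev_U: "\<forall>\<^sub>F b in U. b \<in> X i" if "i \<in> I" for i
  proof -
    have "\<forall>\<^sub>F b in F. b \<in> X i" using that ev_F by (auto simp: eventually_principal)
    then show ?thesis using U(1) by (rule filter_leD[rotated])
  qed
  have "({}, 0) \<in> I" by (simp add: I_def)
  from ev_U[OF this] have "\<forall>\<^sub>F b in U. b \<in> tuples M n"
    by (rule eventually_mono) (simp add: X_def)
  then interpret skolem_ultrapower L M n U h
    using U inj_h M by unfold_locales (auto simp: models_def)
  let ?S = "{a \<in> univ skolem_hull. holds skolem_hull \<phi> (a # generic)}"
  have hull: "skolem_hull \<in> models L T" by (rule hull_models[OF M T])
  have lin': "is_linear skolem_hull lt" by (rule models_is_linear(1)[OF order hull])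
  have "definable L skolem_hull ?S"
    unfolding definable_def using \<phi> generic_tuple by blast
  then have "?S \<in> bool_comb (univ skolem_hull) ({{a} | a. a \<in> univ skolem_hull} \<union>
      intervals lt skolem_hull \<union> {Z. zero_definable L skolem_hull Z})"
    using qom hull unfolding quasi_o_minimal_def by blast
  from bool_comb_locally_constant[OF lin' this]
  obtain \<Psi> E where \<Psi>: "finite \<Psi>" "\<Psi> \<subseteq> fmlas L 1" "finite E" "E \<subseteq> univ skolem_hull"
    "locally_constant_off skolem_hull lt \<Psi> E ?S"
    by (elim exE conjE) (rule that)
  \<comment> \<open>Both \<Psi> and E come from this single tuple. That is enough, because the tuple
    is bad for every pair, in particular for this one.\<close>
  let ?N = "2 * card E + 2"
  have cong: "alternates skolem_hull lt D (\<lambda>z. holds skolem_hull \<phi> (z # generic)) i x \<longleftrightarrow>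
    alternates skolem_hull lt D (\<lambda>z. z \<in> ?S) i x" for D i x
    by (rule alternates_cong) simp
  have "\<not> K \<Psi> ?N skolem_hull generic"
    unfolding K_def cong using locally_constant_bounds_alternation[OF lin' \<Psi>(3-5)] by blast
  moreover have "definable_rel L n (K \<Psi> ?N)"
  proof -
    have "definable_rel L n (\<lambda>(M :: ('f, 'r, 'm) struct) b. \<exists>p\<in>Pow \<Psi>. \<exists>x\<in>univ M.
      alternates M lt (cell M \<Psi> p) (\<lambda>z. holds M \<phi> (z # tl (x # b))) ?N (hd (x # b)))"
      using \<Psi>(1)
      by (intro definable_rel_finite_Bex definable_rel_Ex
          definable_rel_alternates[OF lt \<Psi>(1,2) \<phi>, unfolded plus_1_eq_Suc]) simp
    then show ?thesis by (rule definable_rel_cong) (simp add: K_def)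
  qed
  then obtain \<kappa> where \<kappa>: "\<kappa> \<in> fmlas L n"
    "\<And>(M :: ('f, 'r, 'm) struct) b. b \<in> tuples M n \<Longrightarrow> holds M \<kappa> b \<longleftrightarrow> K \<Psi> ?N M b"
    unfolding definable_rel_def by blast
  have "(\<Psi>, ?N) \<in> I" using \<Psi> by (simp add: I_def)
  from ev_U[OF this] have "\<forall>\<^sub>F b in U. holds M \<kappa> b"
    by (rule eventually_mono) (use \<kappa>(2) in \<open>auto simp: X_def\<close>)
  then have "holds skolem_hull \<kappa> generic" using holds_generic[OF \<kappa>(1)] by blast
  then have "K \<Psi> ?N skolem_hull generic" using \<kappa>(2)[OF generic_tuple] by blast
  ultimately show False by blast
qed

section \<open>The VC1 property\<close>

text \<open>Both sets are final segments of the same linear order. They are compared across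
  different formulas, cells, parameters and lengths, as all of these occur together in the type of
  one point.\<close>

lemma alternates_sets_linear:
  assumes "is_linear M lt"
  shows "{x\<in>univ M. alternates M lt D P i x} \<subseteq> {x\<in>univ M. alternates M lt D' P' j x} \<or>
    {x\<in>univ M. alternates M lt D' P' j x} \<subseteq> {x\<in>univ M. alternates M lt D P i x}"
proof (rule ccontr)
  assume "\<not> ?thesis"
  then obtain x y where x: "x \<in> univ M" "alternates M lt D P i x" "\<not> alternates M lt D' P' j x"
    and y: "y \<in> univ M" "alternates M lt D' P' j y" "\<not> alternates M lt D P i y" by blast
  have "relI M lt [x, y] \<or> x = y \<or> relI M lt [y, x]"
    by (rule is_linearD(3)[OF assms x(1) y(1)])
  then show False
    using x y alternates_mono[OF assms x(1) y(1)] alternates_mono[OF assms y(1) x(1)] by metis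
qed

text \<open>Inclusion of segments replaces membership of the point a, which a defining formula may
  not mention. The first block of c is y and the second is the parameter chosen from B, in the order
  fixed by \<open>uniform_definition\<close>.\<close>

lemma definable_rel_alternates_subset:
  fixes L :: "('f, 'r) lang"
  assumes "rarity L lt = Some 2" "finite \<Psi>" "\<Psi> \<subseteq> fmlas L 1" "\<phi> \<in> fmlas L (1 + n)"
    "finite \<Psi>'" "\<Psi>' \<subseteq> fmlas L 1" "\<phi>' \<in> fmlas L (1 + n)"
  shows "definable_rel L (n + n) (\<lambda>(M :: ('f, 'r, 'm) struct) c. \<forall>x\<in>univ M.
    alternates M lt (cell M \<Psi> p) (\<lambda>z. holds M \<phi> (z # drop n c)) i x \<longrightarrow>
    alternates M lt (cell M \<Psi>' p') (\<lambda>z. holds M \<phi>' (z # take n c)) j x)"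
proof -
  let ?js = "0 # [Suc n..<Suc n + n]" and ?js' = "0 # [Suc 0..<Suc 0 + n]"
  let ?A = "\<lambda>(M :: ('f, 'r, 'm) struct) a.
    alternates M lt (cell M \<Psi> p) (\<lambda>z. holds M \<phi> (z # tl a)) i (hd a)"
  let ?A' = "\<lambda>(M :: ('f, 'r, 'm) struct) a.
    alternates M lt (cell M \<Psi>' p') (\<lambda>z. holds M \<phi>' (z # tl a)) j (hd a)"
  have js: "length ?js = 1 + n" "set ?js \<subseteq> {..<Suc (n + n)}"
    "length ?js' = 1 + n" "set ?js' \<subseteq> {..<Suc (n + n)}" by auto
  have "definable_rel L (Suc (n + n)) (\<lambda>M a. ?A M (map ((!) a) ?js) \<longrightarrow> ?A' M (map ((!) a) ?js'))"
    by (rule definable_rel_imp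
        definable_rel_subst[OF definable_rel_alternates[OF assms(1-4)] js(1,2)]
        definable_rel_subst[OF definable_rel_alternates[OF assms(1,5-7)] js(3,4)])+
  from definable_rel_All[OF this] show ?thesis
  proof (rule definable_rel_cong)
    fix M :: "('f, 'r, 'm) struct" and c assume "c \<in> tuples M (n + n)"
    then have len: "length c = n + n" by (simp add: tuples_def)
    have "map ((!) (x # c)) ?js = x # drop n c" "map ((!) (x # c)) ?js' = x # take n c" for x
      using len by (auto intro!: nth_equalityI simp: nth_Cons' simp del: upt_Suc)
    then show "(\<forall>x\<in>univ M. ?A M (map ((!) (x # c)) ?js) \<longrightarrow> ?A' M (map ((!) (x # c)) ?js')) \<longleftrightarrow>
      (\<forall>x\<in>univ M. alternates M lt (cell M \<Psi> p) (\<lambda>z. holds M \<phi> (z # drop n c)) i x \<longrightarrow>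
        alternates M lt (cell M \<Psi>' p') (\<lambda>z. holds M \<phi>' (z # take n c)) j x)"
      by simp
  qed
qed

text \<open>Given x, take its cell p and the smallest segment \<open>V g b\<^sub>1\<close> over B
  that contains x. A segment over B contains x exactly if it includes this one, and the parity of
  the greatest chain length returns the truth value of each \<phi>. The finite data (g, p) index the
  family, and \<open>b\<^sub>1\<close> is the parameter.\<close>

lemma VC1_if_alternation_bounded:
  fixes L :: "('f, 'r) lang" and M :: "('f, 'r, 'm) struct"
  assumes lin: "is_linear M lt" and lt: "rarity L lt = Some 2"
    and bound: "\<And>n \<phi>. \<phi> \<in> fmlas L (1 + n) \<Longrightarrow> \<exists>\<Psi> N. finite \<Psi> \<and> \<Psi> \<subseteq> fmlas L 1 \<and>
      (\<forall>b\<in>tuples M n. \<forall>p. \<forall>x\<in>univ M. \<not> alternates M lt (cell M \<Psi> p) (\<lambda>z. holds M \<phi> (z # b)) N x)"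
  shows "VC_property_struct L M 1"
  unfolding VC_property_struct_def
proof (intro allI impI, elim conjE)
  fix n and \<Delta> :: "('f, 'r) fm set"
  assume \<Delta>: "finite \<Delta>" "\<Delta> \<noteq> {}" "\<Delta> \<subseteq> fmlas L (1 + n)"
  have "\<forall>\<phi>\<in>\<Delta>. \<exists>\<Psi>N. finite (fst \<Psi>N) \<and> fst \<Psi>N \<subseteq> fmlas L 1 \<and> (\<forall>b\<in>tuples M n. \<forall>p. \<forall>x\<in>univ M.
    \<not> alternates M lt (cell M (fst \<Psi>N) p) (\<lambda>z. holds M \<phi> (z # b)) (snd \<Psi>N) x)"
    using bound \<Delta>(3) by fastforce
  from bchoice[OF this] obtain \<Psi>N where \<Psi>N: "\<forall>\<phi>\<in>\<Delta>. finite (fst (\<Psi>N \<phi>)) \<and>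
    fst (\<Psi>N \<phi>) \<subseteq> fmlas L 1 \<and> (\<forall>b\<in>tuples M n. \<forall>p. \<forall>x\<in>univ M.
    \<not> alternates M lt (cell M (fst (\<Psi>N \<phi>)) p) (\<lambda>z. holds M \<phi> (z # b)) (snd (\<Psi>N \<phi>)) x)" ..
  define \<Psi> where "\<Psi> \<phi> = fst (\<Psi>N \<phi>)" for \<phi>
  define N where "N \<phi> = snd (\<Psi>N \<phi>)" for \<phi>
  have \<Psi>: "finite (\<Psi> \<phi>)" "\<Psi> \<phi> \<subseteq> fmlas L 1" if "\<phi> \<in> \<Delta>" for \<phi>
    using \<Psi>N that by (auto simp: \<Psi>_def)
  have N: "\<not> alternates M lt (cell M (\<Psi> \<phi>) p) (\<lambda>z. holds M \<phi> (z # b)) (N \<phi>) x"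
    if "\<phi> \<in> \<Delta>" "b \<in> tuples M n" "x \<in> univ M" for \<phi> b p x
    using \<Psi>N that by (auto simp: \<Psi>_def N_def)
  define Q where "Q = Pow (\<Union>\<phi>\<in>\<Delta>. \<Psi> \<phi>)"
  \<comment> \<open>The bound \<open>N \<phi>\<close> is included, since i and \<open>Suc i\<close>
    are both compared for i < \<open>N \<phi>\<close>.\<close>
  define G where "G = (SIGMA \<phi>:\<Delta>. Q \<times> {..N \<phi>})"
  define V where "V = (\<lambda>(\<phi>, p, i) b.
    {x\<in>univ M. alternates M lt (cell M (\<Psi> \<phi>) p) (\<lambda>z. holds M \<phi> (z # b)) i x})"
  have fin: "finite Q" "finite G"
    using \<Delta>(1) \<Psi>(1) by (auto simp: Q_def G_def)
  have V_linear: "V g b \<subseteq> V g' b' \<or> V g' b' \<subseteq> V g b" for g g' b b'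
    using alternates_sets_linear[OF lin] by (cases g; cases g') (auto simp: V_def)
  have ex_formula: "\<exists>\<theta>. \<theta> \<in> fmlas L (n + 1 * n) \<and> (\<forall>b\<in>tuples M n. \<forall>b'\<in>tuples M n. holds M \<theta> (b @ b') \<longleftrightarrow>
      (\<exists>i\<in>{i. i < N \<phi> \<and> odd i}. V g b' \<subseteq> V (\<phi>, p, i) b \<and> \<not> V g b' \<subseteq> V (\<phi>, p, Suc i) b))"
    if g: "g \<in> G" and \<phi>: "\<phi> \<in> \<Delta>" for g p \<phi>
  proof -
    obtain \<phi>' p' i' where g': "g = (\<phi>', p', i')" "\<phi>' \<in> \<Delta>" using g by (auto simp: G_def)
    let ?R = "\<lambda>j (M :: ('f, 'r, 'm) struct) c. \<forall>x\<in>univ M.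
      alternates M lt (cell M (\<Psi> \<phi>') p') (\<lambda>z. holds M \<phi>' (z # drop n c)) i' x \<longrightarrow>
      alternates M lt (cell M (\<Psi> \<phi>) p) (\<lambda>z. holds M \<phi> (z # take n c)) j x"
    have R: "definable_rel L (n + n) (?R j)" for j
      using \<Psi> \<Delta>(3) \<phi> g'(2) by (intro definable_rel_alternates_subset lt) auto
    have "definable_rel L (n + n) (\<lambda>M c. \<exists>i\<in>{i. i < N \<phi> \<and> odd i}. ?R i M c \<and> \<not> ?R (Suc i) M c)"
      by (intro definable_rel_finite_Bex definable_rel_conj definable_rel_not R) simp
    then obtain \<theta> where \<theta>: "\<theta> \<in> fmlas L (n + n)" "\<And>c. c \<in> tuples M (n + n) \<Longrightarrow> holds M \<theta> c \<longleftrightarrow>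
      (\<exists>i\<in>{i. i < N \<phi> \<and> odd i}. ?R i M c \<and> \<not> ?R (Suc i) M c)"
      unfolding definable_rel_def by blast
    have "holds M \<theta> (b @ b') \<longleftrightarrow>
      (\<exists>i\<in>{i. i < N \<phi> \<and> odd i}. V g b' \<subseteq> V (\<phi>, p, i) b \<and> \<not> V g b' \<subseteq> V (\<phi>, p, Suc i) b)"
      if b: "b \<in> tuples M n" "b' \<in> tuples M n" for b b'
    proof -
      have "b @ b' \<in> tuples M (n + n)" "take n (b @ b') = b" "drop n (b @ b') = b'"
        using b by (auto simp: tuples_def)
      moreover have "V g b' \<subseteq> V (\<phi>, p, j) b \<longleftrightarrow> ?R j M (b @ b')" for j
        using calculation by (auto simp: V_def g'(1))
      ultimately show ?thesis using \<theta>(2) by (simp only:)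
    qed
    then show ?thesis using \<theta>(1) by (intro exI[of _ \<theta>]) simp
  qed
  define \<Theta> where "\<Theta> = (\<lambda>(g, p) \<phi>. SOME \<theta>. \<theta> \<in> fmlas L (n + 1 * n) \<and>
    (\<forall>b\<in>tuples M n. \<forall>b'\<in>tuples M n. holds M \<theta> (b @ b') \<longleftrightarrow>
      (\<exists>i\<in>{i. i < N \<phi> \<and> odd i}. V g b' \<subseteq> V (\<phi>, p, i) b \<and> \<not> V g b' \<subseteq> V (\<phi>, p, Suc i) b)))"
  have \<Theta>: "\<Theta> (g, p) \<phi> \<in> fmlas L (n + 1 * n) \<and>
    (\<forall>b\<in>tuples M n. \<forall>b'\<in>tuples M n. holds M (\<Theta> (g, p) \<phi>) (b @ b') \<longleftrightarrow>
      (\<exists>i\<in>{i. i < N \<phi> \<and> odd i}. V g b' \<subseteq> V (\<phi>, p, i) b \<and> \<not> V g b' \<subseteq> V (\<phi>, p, Suc i) b))"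
    if "g \<in> G" "\<phi> \<in> \<Delta>" for g p \<phi>
    unfolding \<Theta>_def prod.case by (rule someI_ex) (rule ex_formula[OF that])
  have "uniform_definition L M 1 n \<Delta> 1 (\<Theta> ` (G \<times> Q))"
    unfolding uniform_definition_def
  proof (intro conjI allI impI)
    show "finite (\<Theta> ` (G \<times> Q))" using fin by simp
    show "\<forall>F\<in>\<Theta> ` (G \<times> Q). \<forall>\<phi>\<in>\<Delta>. F \<phi> \<in> fmlas L (n + 1 * n)"
      using \<Theta> by blast
  next
    fix B a assume "finite B \<and> B \<noteq> {} \<and> B \<subseteq> tuples M n \<and> a \<in> tuples M 1"
    then have B: "finite B" "B \<noteq> {}" "B \<subseteq> tuples M n" and "a \<in> tuples M 1" by auto
    then obtain x where x: "a = [x]" "x \<in> univ M"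
      by (cases a) (auto simp: tuples_def)
    define p where "p = {\<psi> \<in> (\<Union>\<phi>\<in>\<Delta>. \<Psi> \<phi>). holds M \<psi> [x]}"
    have p: "p \<in> Q" "cell M (\<Psi> \<phi>) p x" if "\<phi> \<in> \<Delta>" for \<phi>
      using that by (auto simp: p_def Q_def cell_def)
    define Y where "Y = {gb \<in> G \<times> B. x \<in> V (fst gb) (snd gb)}"
    obtain \<phi>\<^sub>0 b\<^sub>0 where "\<phi>\<^sub>0 \<in> \<Delta>" "b\<^sub>0 \<in> B" using \<Delta>(2) B(2) by blast
    \<comment> \<open>Length 0 gives the whole universe, so x lies in at least one segment over
      B.\<close>
    then have "((\<phi>\<^sub>0, {}, 0), b\<^sub>0) \<in> Y" using x(2) by (auto simp: Y_def G_def Q_def V_def)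
    moreover have "finite Y" using fin(2) B(1) by (simp add: Y_def)
    ultimately have "\<exists>S\<in>(\<lambda>(g, b). V g b) ` Y. \<forall>S'\<in>(\<lambda>(g, b). V g b) ` Y. S' \<subseteq> S \<longrightarrow> S = S'"
      by (intro finite_has_minimal) auto
    then obtain g b\<^sub>1 where gb: "(g, b\<^sub>1) \<in> Y"
      and "\<forall>S'\<in>(\<lambda>(g, b). V g b) ` Y. S' \<subseteq> V g b\<^sub>1 \<longrightarrow> V g b\<^sub>1 = S'"
      by auto
    then have min: "V g b\<^sub>1 = V g' b'" if "(g', b') \<in> Y" "V g' b' \<subseteq> V g b\<^sub>1" for g' b'
      using that by force
    have g: "g \<in> G" "b\<^sub>1 \<in> B" "x \<in> V g b\<^sub>1" using gb by (auto simp: Y_def)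
    have least: "x \<in> V g' b' \<longleftrightarrow> V g b\<^sub>1 \<subseteq> V g' b'" if "g' \<in> G" "b' \<in> B" for g' b'
    proof
      assume "x \<in> V g' b'"
      then have "(g', b') \<in> Y" using that by (simp add: Y_def)
      then show "V g b\<^sub>1 \<subseteq> V g' b'" using min V_linear[of g b\<^sub>1 g' b'] by blast
    qed (use g(3) in blast)
    have "holds M \<phi> (a @ b) \<longleftrightarrow> holds M (\<Theta> (g, p) \<phi>) (b @ concat [b\<^sub>1])" if \<phi>: "\<phi> \<in> \<Delta>" and b: "b \<in> B" for \<phi> b
    proof -
      have V: "x \<in> V (\<phi>, p, i) b \<longleftrightarrow>
        alternates M lt (cell M (\<Psi> \<phi>) p) (\<lambda>z. holds M \<phi> (z # b)) i x" for i
        using x(2) by (simp add: V_def)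
      have "holds M \<phi> (a @ b) \<longleftrightarrow> holds M \<phi> (x # b)" by (simp add: x(1))
      also have "\<dots> \<longleftrightarrow> (\<exists>i<N \<phi>. odd i \<and> x \<in> V (\<phi>, p, i) b \<and> x \<notin> V (\<phi>, p, Suc i) b)"
        unfolding V using b B(3)
        by (intro parity_of_alternates[where D = "cell M (\<Psi> \<phi>) p", OF lin x(2) p(2)[OF \<phi>]]
              N[OF \<phi> _ x(2)]) blast
      also have "\<dots> \<longleftrightarrow> (\<exists>i\<in>{i. i < N \<phi> \<and> odd i}.
        V g b\<^sub>1 \<subseteq> V (\<phi>, p, i) b \<and> \<not> V g b\<^sub>1 \<subseteq> V (\<phi>, p, Suc i) b)"
      proof -
        have "(\<phi>, p, i) \<in> G" "(\<phi>, p, Suc i) \<in> G" if "i < N \<phi>" for i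
          using that \<phi> p(1) by (auto simp: G_def)
        then show ?thesis using least[OF _ b] by blast
      qed
      also have "\<dots> \<longleftrightarrow> holds M (\<Theta> (g, p) \<phi>) (b @ b\<^sub>1)"
        using \<Theta>[OF g(1) \<phi>, of p] b g(2) B(3) by blast
      finally show ?thesis by simp
    qed
    moreover have "\<Theta> (g, p) \<in> \<Theta> ` (G \<times> Q)"
      using g(1) p(1) \<Delta>(2) by blast
    ultimately show "\<exists>bs. length bs = 1 \<and> set bs \<subseteq> B \<and> (\<exists>F\<in>\<Theta> ` (G \<times> Q). \<forall>\<phi>\<in>\<Delta>. \<forall>b\<in>B.
        holds M \<phi> (a @ b) \<longleftrightarrow> holds M (F \<phi>) (b @ concat bs))"
      using g(2) by (intro exI[of _ "[b\<^sub>1]"] conjI bexI[of _ "\<Theta> (g, p)"] ballI) simp_all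
  qed
  then show "\<exists>\<F>. uniform_definition L M 1 n \<Delta> 1 \<F>" by blast
qed

section \<open>VC density\<close>

lemma ex_formula_subst:
  assumes "\<phi> \<in> fmlas L k" "length js = k" "set js \<subseteq> {..<n}"
  obtains \<theta> where "\<theta> \<in> fmlas L n"
    "\<And>a. a \<in> tuples (M :: ('f, 'r, 'm) struct) n \<Longrightarrow> holds M \<theta> a \<longleftrightarrow> holds M \<phi> (map ((!) a) js)"
  using definable_rel_subst[OF definable_rel_holds[OF assms(1)] assms(2,3)]
  unfolding definable_rel_def by blast

lemma map_nth_append:
  "length xs = i \<Longrightarrow> length ys = n \<Longrightarrow> map ((!) (xs @ ys @ zs)) [i..<i + n] = ys"
  by (auto intro!: nth_equalityI simp: nth_append simp del: upt_Suc)

lemma map_nth_concat: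
  assumes "\<And>c. c \<in> set cs \<Longrightarrow> length c = m" "j < length cs" "length xs = i"
  shows "map ((!) (xs @ concat cs)) [i + j * m..<i + j * m + m] = cs ! j"
  using assms
proof (induction cs arbitrary: j xs i)
  case (Cons c cs)
  show ?case
  proof (cases j)
    case 0
    then show ?thesis using map_nth_append[of xs i c m "concat cs"] Cons.prems by simp
  next
    case (Suc j')
    then show ?thesis using Cons.IH[of j' "xs @ c" "i + m"] Cons.prems by (simp add: add.assoc)
  qed
qed simp

lemma append_tuples: "a \<in> tuples M i \<Longrightarrow> b \<in> tuples M j \<Longrightarrow> a @ b \<in> tuples M (i + j)"
  by (auto simp: tuples_def)

lemma uniform_definitionE:
  assumes "uniform_definition L M m n \<Delta> d \<F>" "finite B" "B \<noteq> {}" "B \<subseteq> tuples M n" "a \<in> tuples M m"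
  obtains bs F where "length bs = d" "set bs \<subseteq> B" "F \<in> \<F>"
    "\<And>\<phi> b. \<phi> \<in> \<Delta> \<Longrightarrow> b \<in> B \<Longrightarrow> holds M \<phi> (a @ b) \<longleftrightarrow> holds M (F \<phi>) (b @ concat bs)"
proof -
  have "\<exists>bs. length bs = d \<and> set bs \<subseteq> B \<and>
    (\<exists>F\<in>\<F>. \<forall>\<phi>\<in>\<Delta>. \<forall>b\<in>B. holds M \<phi> (a @ b) \<longleftrightarrow> holds M (F \<phi>) (b @ concat bs))"
    by (rule assms(1)[unfolded uniform_definition_def, THEN conjunct2, THEN conjunct2, rule_format])
      (use assms(2-5) in blast)
  then show ?thesis using that by (elim exE conjE bexE) blast
qed

text \<open>\<open>VC_property_struct\<close> speaks of non-empty \<Delta> only. With the empty case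
  at hand, the induction on the number of variables can pass to a new set of formulas without first
  proving it non-empty.\<close>

lemma uniform_definition_empty:
  fixes M :: "('f, 'r, 'm) struct"
  shows "uniform_definition L M k m {} d {id}"
proof -
  have "\<exists>bs. length bs = d \<and> set bs \<subseteq> B" if ne: "B \<noteq> {}" for B :: "'m list set"
  proof -
    obtain b where "b \<in> B" using ne by blast
    then show ?thesis by (intro exI[of _ "replicate d b"]) auto
  qed
  then show ?thesis unfolding uniform_definition_def by auto
qed

text \<open>The types of \<open>a\<^sub>0, a'\<close> over \<open>B\<close> are first reduced to types of \<open>a'\<close> over \<open>B \<times> {b\<^sub>1}\<close>, by the case of one
  variable for the parameter set \<open>{a'} \<times> B\<close>. Fixing \<open>b\<^sub>1\<close> in the second coordinate is what keeps the number of
  parameters from doubling.\<close>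

lemma uniform_definition_all_lengths:
  fixes L :: "('f, 'r) lang" and M :: "('f, 'r, 'm) struct"
  assumes VC1: "VC_property_struct L M 1"
    and "finite \<Delta>" "\<Delta> \<subseteq> fmlas L (k + m)"
  shows "\<exists>\<F>. uniform_definition L M k m \<Delta> k \<F>"
  using assms(2,3)
proof (induction k arbitrary: m \<Delta>)
  case 0
  \<comment> \<open>Without object variables a is the empty tuple, and each \<phi> is its own
    definition.\<close>
  have "uniform_definition L M 0 m \<Delta> 0 {id}"
    using 0 by (auto simp: uniform_definition_def tuples_def)
  then show ?case by blast
next
  case (Suc k)
  show ?case
  proof (cases "\<Delta> = {}")
    case True
    then show ?thesis using uniform_definition_empty by blast
  next
    case False
    have "\<Delta> \<subseteq> fmlas L (1 + (k + m))" using Suc.prems(2) by simp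
    then obtain \<F>\<^sub>1 where \<F>\<^sub>1: "uniform_definition L M 1 (k + m) \<Delta> 1 \<F>\<^sub>1"
      using VC1 Suc.prems(1) False unfolding VC_property_struct_def by blast
    \<comment> \<open>The variables of \<theta> are a', b, \<open>b\<^sub>1\<close>; the formula
      \<open>F \<phi>\<close> expects the two parameters (a', b) and (a', \<open>b\<^sub>1\<close>),
      so a' is read twice.\<close>
    let ?js = "[0..<k + m] @ [0..<k] @ [k + m..<k + m + m]"
    have "\<exists>\<theta>. \<theta> \<in> fmlas L (k + (m + m)) \<and>
      (\<forall>a\<in>tuples M (k + (m + m)). holds M \<theta> a \<longleftrightarrow> holds M (F \<phi>) (map ((!) a) ?js))"
      if "F \<in> \<F>\<^sub>1" "\<phi> \<in> \<Delta>" for F \<phi>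
    proof -
      have "F \<phi> \<in> fmlas L (k + m + 1 * (k + m))"
        using \<F>\<^sub>1 that unfolding uniform_definition_def by blast
      then show ?thesis
        by (rule ex_formula_subst[where js = ?js and n = "k + (m + m)" and M = M]) auto
    qed
    then obtain \<theta> where \<theta>: "\<And>F \<phi>. F \<in> \<F>\<^sub>1 \<Longrightarrow> \<phi> \<in> \<Delta> \<Longrightarrow> \<theta> F \<phi> \<in> fmlas L (k + (m + m))"
      "\<And>F \<phi> a. F \<in> \<F>\<^sub>1 \<Longrightarrow> \<phi> \<in> \<Delta> \<Longrightarrow> a \<in> tuples M (k + (m + m)) \<Longrightarrow>
        holds M (\<theta> F \<phi>) a \<longleftrightarrow> holds M (F \<phi>) (map ((!) a) ?js)"
      by metis
    let ?\<Delta>' = "(\<lambda>(F, \<phi>). \<theta> F \<phi>) ` (\<F>\<^sub>1 \<times> \<Delta>)"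
    have "finite \<F>\<^sub>1" using \<F>\<^sub>1 unfolding uniform_definition_def by blast
    then have "finite ?\<Delta>'" "?\<Delta>' \<subseteq> fmlas L (k + (m + m))"
      using Suc.prems(1) \<theta>(1) by auto
    from Suc.IH[OF this] obtain \<F>\<^sub>2 where \<F>\<^sub>2: "uniform_definition L M k (m + m) ?\<Delta>' k \<F>\<^sub>2" ..
    \<comment> \<open>The variables of \<eta> are b, \<open>b\<^sub>1\<close> and k further tuples
      c; the second definition expects (b, \<open>b\<^sub>1\<close>) followed by all (c,
      \<open>b\<^sub>1\<close>), so \<open>b\<^sub>1\<close> is copied into each pair. This leaves 1
      + k parameters.\<close>
    let ?js' = "[0..<m] @ [m..<m + m] @
      concat (map (\<lambda>j. [m + m + j * m..<m + m + j * m + m] @ [m..<m + m]) [0..<k])"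
    have js': "length ?js' = m + m + k * (m + m)" "set ?js' \<subseteq> {..<m + Suc k * m}"
    proof -
      have "(\<Sum>j\<leftarrow>[0..<n]. m + m) = n * (m + m)" for n by (induction n) auto
      then show "length ?js' = m + m + k * (m + m)"
        by (simp add: length_concat comp_def)
      have le: "m + m + j * m + m \<le> m + Suc k * m" if "j < k" for j
        using mult_le_mono1[of "Suc j" k m] that by simp
      have le': "m + m \<le> m + Suc k * m" by simp
      show "set ?js' \<subseteq> {..<m + Suc k * m}"
      proof
        fix i assume "i \<in> set ?js'"
        then have "i < m + m \<or> (\<exists>j<k. i < m + m + j * m + m)"
          by (auto split: if_splits)
        then show "i \<in> {..<m + Suc k * m}"
          unfolding lessThan_iff using less_le_trans[OF _ le] less_le_trans[OF _ le'] by blast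
      qed
    qed
    have ex_\<eta>: "\<exists>\<eta>. \<eta> \<in> fmlas L (m + Suc k * m) \<and>
      (\<forall>a\<in>tuples M (m + Suc k * m). holds M \<eta> a \<longleftrightarrow> holds M (G (\<theta> F \<phi>)) (map ((!) a) ?js'))"
      if "F \<in> \<F>\<^sub>1" "G \<in> \<F>\<^sub>2" "\<phi> \<in> \<Delta>" for F G \<phi>
    proof -
      have "G (\<theta> F \<phi>) \<in> fmlas L (m + m + k * (m + m))"
        using \<F>\<^sub>2 that unfolding uniform_definition_def by blast
      then show ?thesis
        by (rule ex_formula_subst[where js = ?js' and n = "m + Suc k * m" and M = M])
          (use js' in auto)
    qed
    define \<eta> where "\<eta> F G \<phi> = (SOME \<eta>. \<eta> \<in> fmlas L (m + Suc k * m) \<and>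
      (\<forall>a\<in>tuples M (m + Suc k * m). holds M \<eta> a \<longleftrightarrow> holds M (G (\<theta> F \<phi>)) (map ((!) a) ?js')))" for F G \<phi>
    have \<eta>: "\<eta> F G \<phi> \<in> fmlas L (m + Suc k * m)"
      "a \<in> tuples M (m + Suc k * m) \<Longrightarrow>
        holds M (\<eta> F G \<phi>) a \<longleftrightarrow> holds M (G (\<theta> F \<phi>)) (map ((!) a) ?js')"
      if "F \<in> \<F>\<^sub>1" "G \<in> \<F>\<^sub>2" "\<phi> \<in> \<Delta>" for F G \<phi> a
      using someI_ex[OF ex_\<eta>[OF that]] unfolding \<eta>_def[symmetric] by blast+
    have "uniform_definition L M (Suc k) m \<Delta> (Suc k) ((\<lambda>(F, G). \<eta> F G) ` (\<F>\<^sub>1 \<times> \<F>\<^sub>2))"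
      unfolding uniform_definition_def
    proof (intro conjI allI impI)
      have "finite \<F>\<^sub>2" using \<F>\<^sub>2 by (simp add: uniform_definition_def)
      with \<open>finite \<F>\<^sub>1\<close> show "finite ((\<lambda>(F, G). \<eta> F G) ` (\<F>\<^sub>1 \<times> \<F>\<^sub>2))" by simp
      show "\<forall>F\<in>(\<lambda>(F, G). \<eta> F G) ` (\<F>\<^sub>1 \<times> \<F>\<^sub>2). \<forall>\<phi>\<in>\<Delta>. F \<phi> \<in> fmlas L (m + Suc k * m)"
        using \<eta>(1) by auto
    next
      fix B a assume "finite B \<and> B \<noteq> {} \<and> B \<subseteq> tuples M m \<and> a \<in> tuples M (Suc k)"
      then have B: "finite B" "B \<noteq> {}" "B \<subseteq> tuples M m" and "a \<in> tuples M (Suc k)" by auto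
      then obtain x a' where a: "a = x # a'" "[x] \<in> tuples M 1" "a' \<in> tuples M k"
        by (cases a) (auto simp: tuples_def)
      have len: "length b = m" if "b \<in> B" for b using B(3) that by (auto simp: tuples_def)
      let ?B\<^sub>1 = "(@) a' ` B"
      have "finite ?B\<^sub>1" "?B\<^sub>1 \<noteq> {}" "?B\<^sub>1 \<subseteq> tuples M (k + m)"
        using a(3) B by (auto intro: append_tuples)
      from uniform_definitionE[OF \<F>\<^sub>1 this a(2)]
      obtain bs F where bs: "length bs = 1" "set bs \<subseteq> ?B\<^sub>1" and F: "F \<in> \<F>\<^sub>1"
        and F_def: "\<And>\<phi> b. \<phi> \<in> \<Delta> \<Longrightarrow> b \<in> ?B\<^sub>1 \<Longrightarrow> holds M \<phi> ([x] @ b) \<longleftrightarrow> holds M (F \<phi>) (b @ concat bs)"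
        by metis
      then obtain b\<^sub>1 where b\<^sub>1: "bs = [a' @ b\<^sub>1]" "b\<^sub>1 \<in> B"
        by (cases bs) auto
      let ?B\<^sub>2 = "(\<lambda>b. b @ b\<^sub>1) ` B"
      have "finite ?B\<^sub>2" "?B\<^sub>2 \<noteq> {}" "?B\<^sub>2 \<subseteq> tuples M (m + m)"
        using B b\<^sub>1(2) by (auto intro: append_tuples)
      from uniform_definitionE[OF \<F>\<^sub>2 this a(3)]
      obtain cs' G where cs': "length cs' = k" "set cs' \<subseteq> ?B\<^sub>2" and G: "G \<in> \<F>\<^sub>2"
        and G_def: "\<And>\<phi> b. \<phi> \<in> ?\<Delta>' \<Longrightarrow> b \<in> ?B\<^sub>2 \<Longrightarrow> holds M \<phi> (a' @ b) \<longleftrightarrow> holds M (G \<phi>) (b @ concat cs')"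
        by metis
      have "cs' \<in> lists ?B\<^sub>2" using cs'(2) by auto
      then obtain cs where cs: "set cs \<subseteq> B" "cs' = map (\<lambda>c. c @ b\<^sub>1) cs"
        unfolding lists_image by blast
      have "holds M \<phi> (a @ b) \<longleftrightarrow> holds M (\<eta> F G \<phi>) (b @ concat (b\<^sub>1 # cs))" if \<phi>: "\<phi> \<in> \<Delta>" and b: "b \<in> B" for \<phi> b
      proof -
        have js: "map ((!) (a' @ b @ b\<^sub>1)) ?js = (a' @ b) @ (a' @ b\<^sub>1)"
        proof -
          have "length a' = k" using a(3) by (simp add: tuples_def)
          then show ?thesis
            using map_nth_append[of "[]" 0 "a' @ b" "k + m" b\<^sub>1] map_nth_append[of "[]" 0 a' k "b @ b\<^sub>1"]
              map_nth_append[of "a' @ b" "k + m" b\<^sub>1 m "[]"] len[OF b] len[OF b\<^sub>1(2)]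
            by simp
        qed
        have "holds M \<phi> (a @ b) \<longleftrightarrow> holds M \<phi> ([x] @ (a' @ b))" by (simp add: a(1))
        also have "\<dots> \<longleftrightarrow> holds M (F \<phi>) ((a' @ b) @ (a' @ b\<^sub>1))"
          using F_def[OF \<phi>, of "a' @ b"] b b\<^sub>1(1) by simp
        also have "\<dots> \<longleftrightarrow> holds M (\<theta> F \<phi>) (a' @ b @ b\<^sub>1)"
        proof -
          have "a' @ b @ b\<^sub>1 \<in> tuples M (k + (m + m))"
            using a(3) b b\<^sub>1(2) B(3) by (blast intro: append_tuples)
          then show ?thesis using \<theta>(2)[OF F \<phi>] js by metis
        qed
        also have "\<dots> \<longleftrightarrow> holds M (G (\<theta> F \<phi>)) ((b @ b\<^sub>1) @ concat cs')"
          using G_def[of "\<theta> F \<phi>" "b @ b\<^sub>1"] F \<phi> b by auto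
        also have "\<dots> \<longleftrightarrow> holds M (\<eta> F G \<phi>) (b @ concat (b\<^sub>1 # cs))"
        proof -
          let ?a = "b @ b\<^sub>1 @ concat cs"
          have len_cs: "length cs = k" "\<And>c. c \<in> set cs \<Longrightarrow> length c = m"
            using cs cs'(1) len by auto
          have "map ((!) ?a) [m + m + j * m..<m + m + j * m + m] = cs ! j" if "j < k" for j
            using map_nth_concat[of cs m j "b @ b\<^sub>1" "m + m"] len_cs that len[OF b] len[OF b\<^sub>1(2)] by simp
          moreover have *: "map ((!) ?a) [0..<m] = b" "map ((!) ?a) [m..<m + m] = b\<^sub>1"
            using map_nth_append[of "[]" 0 b m] map_nth_append[of b m b\<^sub>1 m] len[OF b] len[OF b\<^sub>1(2)] by simp_all
          ultimately have "map (\<lambda>j. map ((!) ?a) ([m + m + j * m..<m + m + j * m + m] @ [m..<m + m])) [0..<k] =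
            map (\<lambda>j. cs ! j @ b\<^sub>1) [0..<k]" by simp
          also have "\<dots> = cs'"
            using len_cs(1) cs(2) by (auto intro!: nth_equalityI)
          finally have js': "map ((!) ?a) ?js' = (b @ b\<^sub>1) @ concat cs'"
            using * by (simp add: map_concat comp_def)
          have "?a \<in> tuples M (m + Suc k * m)"
          proof -
            have "length (concat cs) = k * m"
              using len_cs by (induction cs arbitrary: k) auto
            moreover have "set (concat cs) \<subseteq> univ M"
              using cs(1) B(3) by (fastforce simp: tuples_def)
            ultimately have "concat cs \<in> tuples M (k * m)" by (simp add: tuples_def)
            then have "?a \<in> tuples M (m + (m + k * m))"
              using b b\<^sub>1(2) B(3) by (blast intro: append_tuples)
            then show ?thesis by simp
          qed
          from \<eta>(2)[OF F G \<phi> this] show ?thesis unfolding js' by simp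
        qed
        finally show ?thesis .
      qed
      then show "\<exists>bs. length bs = Suc k \<and> set bs \<subseteq> B \<and>
        (\<exists>F\<in>(\<lambda>(F, G). \<eta> F G) ` (\<F>\<^sub>1 \<times> \<F>\<^sub>2). \<forall>\<phi>\<in>\<Delta>. \<forall>b\<in>B.
          holds M \<phi> (a @ b) \<longleftrightarrow> holds M (F \<phi>) (b @ concat bs))"
        using F G b\<^sub>1(2) cs cs'(1)
        by (intro exI[of _ "b\<^sub>1 # cs"] conjI bexI[of _ "\<eta> F G"] ballI) auto
    qed
    then show ?thesis by blast
  qed
qed

section \<open>Upper bound for the VC density\<close>

lemma shatter_function_le:
  fixes L :: "('f, 'r) lang" and M :: "('f, 'r, 'm) struct"
  assumes VC1: "VC_property_struct L M 1" and \<phi>: "\<phi> \<in> fmlas L (m + n)"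
  shows "\<exists>C. \<forall>t\<ge>1. shatter_function M m n \<phi> t \<le> C * t ^ n"
proof -
  \<comment> \<open>The trace of \<phi>(x;b) on A is the type of b over A, so \<theta> exchanges the
    two blocks: the n variables of y become the objects and A the parameter set. A type is then
    given by a member of \<F> and n elements of A.\<close>
  let ?js = "[n..<n + m] @ [0..<n]"
  obtain \<theta> where \<theta>: "\<theta> \<in> fmlas L (n + m)"
    "\<And>a. a \<in> tuples M (n + m) \<Longrightarrow> holds M \<theta> a \<longleftrightarrow> holds M \<phi> (map ((!) a) ?js)"
    by (rule ex_formula_subst[OF \<phi>, of ?js "n + m" M]) auto
  have swap: "holds M \<theta> (b @ a) \<longleftrightarrow> holds M \<phi> (a @ b)" if "a \<in> tuples M m" "b \<in> tuples M n" for a b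
  proof -
    have "map ((!) (b @ a)) ?js = a @ b"
      using map_nth_append[of b n a m "[]"] map_nth_append[of "[]" 0 b n a] that
      by (simp add: tuples_def)
    moreover have "b @ a \<in> tuples M (n + m)" using that by (blast intro: append_tuples)
    ultimately show ?thesis using \<theta>(2) by metis
  qed
  obtain \<F> where \<F>: "uniform_definition L M n m {\<theta>} n \<F>"
    using uniform_definition_all_lengths[OF VC1, of "{\<theta>}" n m] \<theta>(1) by auto
  have fin: "finite \<F>" using \<F> by (simp add: uniform_definition_def)
  have bound: "card {S \<inter> A | S. S \<in> def_family M m n \<phi>} \<le> card \<F> * t ^ n"
    if A: "A \<subseteq> tuples M m" "finite A" "card A = t" and t: "t \<ge> 1" for A t
  proof -
    let ?Q = "{bs. set bs \<subseteq> A \<and> length bs = n} \<times> \<F>"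
    let ?f = "\<lambda>(bs, F). {a\<in>A. holds M (F \<theta>) (a @ concat bs)}"
    have "{S \<inter> A | S. S \<in> def_family M m n \<phi>} \<subseteq> ?f ` ?Q"
    proof
      fix S' assume "S' \<in> {S \<inter> A | S. S \<in> def_family M m n \<phi>}"
      then obtain b where b: "b \<in> tuples M n" "S' = {a\<in>tuples M m. holds M \<phi> (a @ b)} \<inter> A"
        unfolding def_family_def by blast
      have "A \<noteq> {}" using A t by auto
      from uniform_definitionE[OF \<F> A(2) this A(1) b(1)]
      obtain bs F where "length bs = n" "set bs \<subseteq> A" "F \<in> \<F>"
        and F: "\<And>a. a \<in> A \<Longrightarrow> holds M \<theta> (b @ a) \<longleftrightarrow> holds M (F \<theta>) (a @ concat bs)"
        by (metis singletonI)
      moreover have "holds M \<phi> (a @ b) \<longleftrightarrow> holds M (F \<theta>) (a @ concat bs)" if "a \<in> A" for a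
        using F[OF that] swap[OF _ b(1)] A(1) that by blast
      then have "S' = ?f (bs, F)" using b(2) A(1) by auto
      ultimately show "S' \<in> ?f ` ?Q" by blast
    qed
    moreover have "finite ?Q" using A(2) fin finite_lists_length_eq[of A n] by simp
    ultimately have "card {S \<inter> A | S. S \<in> def_family M m n \<phi>} \<le> card ?Q"
      by (meson card_image_le card_mono finite_imageI le_trans)
    also have "card ?Q = card \<F> * t ^ n"
      using A(2,3) by (simp add: card_cartesian_product card_lists_length_eq)
    finally show ?thesis .
  qed
  have "shatter_function M m n \<phi> t \<le> card \<F> * t ^ n" if "t \<ge> 1" for t
  proof -
    let ?X = "{card {S \<inter> A | S. S \<in> def_family M m n \<phi>} | A. A \<subseteq> tuples M m \<and> finite A \<and> card A = t}"
    show ?thesis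
    proof (cases "?X = {}")
      case True
      then show ?thesis unfolding shatter_function_def True by (simp add: Sup_nat_def)
    next
      case False
      then show ?thesis
        unfolding shatter_function_def by (rule cSup_least) (use bound that in blast)
    qed
  qed
  then show ?thesis by blast
qed

text \<open>The condition r > 0 excludes the exponent n itself when n = 0; n + e is admissible for
  every e > 0.\<close>

lemma vc_density_le:
  fixes L :: "('f, 'r) lang" and M :: "('f, 'r, 'm) struct"
  assumes "VC_property_struct L M 1" "\<phi> \<in> fmlas L (m + n)"
  shows "vc_density M m n \<phi> \<le> ereal (real n)"
proof (rule ereal_le_epsilon2)
  fix e :: real assume e: "e > 0"
  obtain C where C: "\<And>t. t \<ge> 1 \<Longrightarrow> shatter_function M m n \<phi> t \<le> C * t ^ n"
    using shatter_function_le[OF assms] by blast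
  have "(\<lambda>t. real (shatter_function M m n \<phi> t)) \<in> O(\<lambda>t. real t powr (n + e))"
  proof (rule bigoI, rule eventually_mono[OF eventually_ge_at_top[of 1]])
    fix t :: nat assume t: "t \<ge> 1"
    have "real (shatter_function M m n \<phi> t) \<le> real (C * t ^ n)"
      using C[OF t] of_nat_mono by blast
    also have "\<dots> = real C * real t powr n"
      using t by (simp add: powr_realpow)
    also have "\<dots> \<le> real C * real t powr (n + e)"
      using t e by (intro mult_left_mono powr_mono) auto
    finally show "norm (real (shatter_function M m n \<phi> t)) \<le> real C * norm (real t powr (n + e))"
      by simp
  qed
  then have "vc_density M m n \<phi> \<le> ereal (n + e)"
    unfolding vc_density_def using e by (intro Inf_lower) (auto intro!: exI[of _ "n + e"])
  then show "vc_density M m n \<phi> \<le> ereal (real n) + ereal e" by simp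
qed

section \<open>Lower bound for the VC density\<close>

lemma shatter_function_ge:
  assumes "finite A" "A \<subseteq> tuples M m" "card A = t"
  shows "card {S \<inter> A | S. S \<in> def_family M m n \<phi>} \<le> shatter_function M m n \<phi> t"
  unfolding shatter_function_def
proof (rule cSup_upper)
  show "card {S \<inter> A | S. S \<in> def_family M m n \<phi>} \<in> {card {S \<inter> A | S. S \<in> def_family M m n \<phi>} | A.
    A \<subseteq> tuples M m \<and> finite A \<and> card A = t}"
    using assms by blast
  show "bdd_above {card {S \<inter> A | S. S \<in> def_family M m n \<phi>} | A.
    A \<subseteq> tuples M m \<and> finite A \<and> card A = t}"
  proof (rule bdd_aboveI)
    fix c assume "c \<in> {card {S \<inter> A | S. S \<in> def_family M m n \<phi>} | A.
      A \<subseteq> tuples M m \<and> finite A \<and> card A = t}"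
    then obtain A where A: "c = card {S \<inter> A | S. S \<in> def_family M m n \<phi>}" "finite A" "card A = t"
      by blast
    have "c \<le> card (Pow A)"
      unfolding A(1) by (rule card_mono) (use A(2) in auto)
    then show "c \<le> 2 ^ t" using A(2,3) by (simp add: card_Pow)
  qed
qed

text \<open>Every n-element subset of a finite A is the trace given by a tuple b enumerating it. So
  the shatter function is at least t choose n, which is at least (t/n)^n for t \<ge> n \<ge> 1; this
  explains the constant n^n.\<close>

lemma ex_vc_density_ge:
  fixes L :: "('f, 'r) lang" and M :: "('f, 'r, 'm) struct"
  assumes inf: "infinite (univ M)"
  shows "\<exists>\<phi>\<in>fmlas L (1 + n). ereal (real n) \<le> vc_density M 1 n \<phi>"
proof -
  have "definable_rel L (1 + n) (\<lambda>(M :: ('f, 'r, 'm) struct) a. \<exists>i\<in>{1..n}. a ! 0 = a ! i)"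
    by (intro definable_rel_finite_Bex definable_rel_eq) auto
  then obtain \<phi> where \<phi>: "\<phi> \<in> fmlas L (1 + n)"
    "\<And>a. a \<in> tuples M (1 + n) \<Longrightarrow> holds M \<phi> a \<longleftrightarrow> (\<exists>i\<in>{1..n}. a ! 0 = a ! i)"
    unfolding definable_rel_def by blast
  have holds: "holds M \<phi> ([x] @ b) \<longleftrightarrow> x \<in> set b" if "x \<in> univ M" "b \<in> tuples M n" for x b
  proof -
    have "[x] @ b \<in> tuples M (1 + n)" using that by (auto simp: tuples_def)
    then have "holds M \<phi> ([x] @ b) \<longleftrightarrow> (\<exists>i\<in>{1..n}. x = (x # b) ! i)"
      using \<phi>(2) by fastforce
    also have "\<dots> \<longleftrightarrow> (\<exists>i<n. x = b ! i)"
    proof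
      assume "\<exists>i\<in>{1..n}. x = (x # b) ! i"
      then obtain i where "i \<in> {1..n}" "x = (x # b) ! i" by blast
      then show "\<exists>i<n. x = b ! i" by (intro exI[of _ "i - 1"]) (auto simp: nth_Cons')
    next
      assume "\<exists>i<n. x = b ! i"
      then obtain i where "i < n" "x = b ! i" by blast
      then show "\<exists>i\<in>{1..n}. x = (x # b) ! i" by (intro bexI[of _ "Suc i"]) auto
    qed
    also have "\<dots> \<longleftrightarrow> x \<in> set b" using that(2) by (auto simp: tuples_def in_set_conv_nth)
    finally show ?thesis .
  qed
  have binom: "t choose n \<le> shatter_function M 1 n \<phi> t" for t
  proof -
    obtain A' where A': "A' \<subseteq> univ M" "finite A'" "card A' = t"
      using infinite_arbitrarily_large[OF inf] by blast
    define A where "A = (\<lambda>x. [x]) ` A'"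
    have A: "A \<subseteq> tuples M 1" "finite A" "card A = t"
      using A' by (auto simp: A_def tuples_def card_image inj_on_def)
    have "{D. D \<subseteq> A \<and> card D = n} \<subseteq> {S \<inter> A | S. S \<in> def_family M 1 n \<phi>}"
    proof
      fix D assume "D \<in> {D. D \<subseteq> A \<and> card D = n}"
      then have D: "D \<subseteq> A" "card D = n" by auto
      obtain ds where ds: "set ds = D" "distinct ds"
        using finite_distinct_list[of D] finite_subset[OF D(1) A(2)] by blast
      define b where "b = map hd ds"
      have b: "b \<in> tuples M n"
        using ds D A(1) distinct_card[OF ds(2)] by (fastforce simp: b_def tuples_def length_Suc_conv)
      have mem: "[x] \<in> D \<longleftrightarrow> x \<in> set b" for x
        using D(1) by (force simp: b_def ds(1) A_def)
      have "D = {a \<in> tuples M 1. holds M \<phi> (a @ b)} \<inter> A"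
      proof (rule set_eqI)
        fix a
        show "a \<in> D \<longleftrightarrow> a \<in> {a \<in> tuples M 1. holds M \<phi> (a @ b)} \<inter> A"
        proof (cases "a \<in> A")
          case True
          then obtain x where "a = [x]" "x \<in> univ M" using A'(1) by (auto simp: A_def)
          then show ?thesis using holds[OF _ b] mem True A(1) by auto
        qed (use D(1) in blast)
      qed
      then show "D \<in> {S \<inter> A | S. S \<in> def_family M 1 n \<phi>}"
        using b unfolding def_family_def by blast
    qed
    moreover have "finite {S \<inter> A | S. S \<in> def_family M 1 n \<phi>}"
      by (rule finite_subset[of _ "Pow A"]) (use A(2) in auto)
    ultimately have "card {D. D \<subseteq> A \<and> card D = n} \<le> card {S \<inter> A | S. S \<in> def_family M 1 n \<phi>}"
      by (intro card_mono)
    also have "\<dots> \<le> shatter_function M 1 n \<phi> t"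
      by (rule shatter_function_ge) (use A in auto)
    finally show ?thesis using n_subsets[OF A(2), of n] A(3) by simp
  qed
  have "real n \<le> r" if r: "r > 0" "(\<lambda>t. real (shatter_function M 1 n \<phi> t)) \<in> O(\<lambda>t. real t powr r)" for r
  proof (cases "n = 0")
    case False
    have "(\<lambda>t. real t powr n) \<in> O(\<lambda>t. real (shatter_function M 1 n \<phi> t))"
    proof (rule bigoI, rule eventually_mono[OF eventually_ge_at_top[of n]])
      fix t :: nat assume t: "t \<ge> n"
      have "real t powr n = real n ^ n * (real t / real n) ^ n"
        using t False by (simp add: powr_realpow power_divide)
      also have "\<dots> \<le> real n ^ n * real (t choose n)"
        by (intro mult_left_mono binomial_ge_n_over_k_pow_k t) simp
      also have "\<dots> \<le> real n ^ n * real (shatter_function M 1 n \<phi> t)"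
        by (intro mult_left_mono of_nat_mono binom) simp
      finally show "norm (real t powr n) \<le> real n ^ n * norm (real (shatter_function M 1 n \<phi> t))"
        by simp
    qed
    then have "(\<lambda>t. real t powr n) \<in> O(\<lambda>t. real t powr r)"
      using r(2) by (rule landau_o.big_trans)
    then show ?thesis
      by (subst (asm) powr_bigo_iff) (auto intro: filterlim_real_sequentially)
  qed (use r(1) in simp)
  then have "ereal (real n) \<le> vc_density M 1 n \<phi>"
    unfolding vc_density_def by (intro Inf_greatest) auto
  then show ?thesis using \<phi>(1) by blast
qed

lemma vc_fun_eq:
  assumes "VC_property_struct L M 1" "infinite (univ M)"
  shows "vc_fun L M n = ereal (real n)"
proof (rule antisym)
  show "vc_fun L M n \<le> ereal (real n)"
    unfolding vc_fun_def using vc_density_le[OF assms(1)] by (intro Sup_least) blast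
  obtain \<phi> where "\<phi> \<in> fmlas L (1 + n)" "ereal (real n) \<le> vc_density M 1 n \<phi>"
    using ex_vc_density_ge[OF assms(2)] by blast
  then show "ereal (real n) \<le> vc_fun L M n"
    unfolding vc_fun_def by (intro Sup_upper2[of "vc_density M 1 n \<phi>"]) blast+
qed

theorem theorem6p4:
  fixes L :: "('f, 'r) lang" and lt :: 'r and T :: "('f, 'r) fm set"
  assumes universe: "\<exists>h :: ('f, 'r) fm \<Rightarrow> 'm. inj_on h {\<phi>. wf_fm L \<phi>}"
    and lt: "rarity L lt = Some 2"
    and complete: "complete_theory TYPE('m) L T"
    and order: "extends_theory TYPE('m) L T (infinite_linear_order_axioms lt)"
    and qom: "quasi_o_minimal TYPE('m) L lt T"
  shows "VC_property TYPE('m) L T 1 \<and>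
    (\<forall>M\<in>(models L T :: ('f, 'r, 'm) struct set). \<forall>n::nat. vc_fun L M n = ereal (real n))"
proof -
  obtain h :: "('f, 'r) fm \<Rightarrow> 'm" where inj_h: "inj_on h {\<phi>. wf_fm L \<phi>}"
    using universe by blast
  have T: "T \<subseteq> sentences L" using complete by (simp add: complete_theory_def)
  have VC1: "VC_property_struct L M 1" if M: "M \<in> models L T" for M :: "('f, 'r, 'm) struct"
    by (rule VC1_if_alternation_bounded[OF models_is_linear(1)[OF order M] lt])
      (rule uniform_alternation_bound[OF inj_h lt T order qom M])
  then have "VC_property TYPE('m) L T 1"
    by (simp add: VC_property_def)
  moreover have "vc_fun L M n = ereal (real n)" if M: "M \<in> models L T"
    for M :: "('f, 'r, 'm) struct" and n
    by (rule vc_fun_eq[OF VC1[OF M] models_is_linear(2)[OF order M]])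
  ultimately show ?thesis by blast
qed

end
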